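(* Let $(D_\lambda)_{\lambda\in\Lambda}$ be a family of Prüfer domains, $R=\prod_{\lambda\in\Lambda}D_\lambda$ and $X=\dot\bigcup_{\lambda\in\Lambda}\max(D_\lambda)$. The prime ideals of $R$ are exactly the unions of non-empty sets of prime ideals of the form $(\mathcal{U})^g$, where $\mathcal{U}$ is an ultrafilter on $X$ (the same for all members of the union) and $g\in\Gamma_{\mathcal{U}}\cup\{\infty\}$ with $g>0$. That is, a subset $\mathfrak{P}\subseteq R$ is a prime ideal of $R$ if and only if there exist an ultrafilter $\mathcal{U}$ on $X$ and a non-empty set $I\subseteq\{g\in\Gamma_{\mathcal{U}}\cup\{\infty\}\mid g>0\}$ such that $\mathfrak{P}=\bigcup_{g\in I}(\mathcal{U})^g$.
   Context: $\max(D)$ is the set of maximal ideals of $D$. $X=\dot\bigcup_{\lambda\in\Lambda}\max(D_\lambda)$ is the disjoint union; for $M\in X$, $\lambda$ denotes the index with $M\in\max(D_\lambda)$. $K_\lambda$ is the quotient field of $D_\lambda$; for $M\in\max(D_\lambda)$, $v_M:K_\lambda\to\Gamma_M\cup\{\infty\}$ is the valuation with valuation ring the localization $(D_\lambda)_M$ and value group $\Gamma_M$ (a totally ordered abelian group). Given an ultrafilter $\mathcal{U}$ on $X$, let $\mathcal{F}_{\mathcal{U}}=\{F_U\mid U\in\mathcal{U}\}$ with $F_U=\{\lambda\in\Lambda\mid U\cap\max(D_\lambda)\neq\emptyset\}$; this is an ultrafilter on $\Lambda$. Let $R^*=\prod^{\mathcal{F}_{\mathcal{U}}}_{\lambda}D_\lambda$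 be the ultraproduct, $x^*$ the image of $x\in R$ in $R^*$, and $K^*=\prod_\lambda^{\mathcal{F}_{\mathcal{U}}}K_\lambda$ the quotient field of $R^*$. Let $\Gamma_{\mathcal{U}}=\prod^{\mathcal{U}}_{M\in X}\Gamma_M$ be the ultraproduct of the value groups (a totally ordered abelian group), and let $v:K^*\to\Gamma_{\mathcal{U}}\cup\{\infty\}$ be the valuation sending a non-zero class $(k_\lambda)_\lambda^{\mathcal{F}_{\mathcal{U}}}$ to the class $(v_M(k_\lambda))_M^{\mathcal{U}}$, with $v(0)=\infty$. For $g\in\Gamma_{\mathcal{U}}\cup\{\infty\}$ with $g>0$, define \[(\mathcal{U})^g=\{x\in R\mid\exists n\in\mathbb{N}\ \ v((x^* )^n)\geq g\}.\] *)

theory Defs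
  imports "HOL-Algebra.Algebra"
begin

section \<open>Quotient fields and Pruefer domains\<close>

definition frac_rel :: "('a, 'm) ring_scheme \<Rightarrow> (('a \<times> 'a) \<times> ('a \<times> 'a)) set"
  where "frac_rel D = {((a, b), (c, d)).
    a \<in> carrier D \<and> b \<in> carrier D - {\<zero>\<^bsub>D\<^esub>} \<and> c \<in> carrier D \<and> d \<in> carrier D - {\<zero>\<^bsub>D\<^esub>} \<and>
    a \<otimes>\<^bsub>D\<^esub> d = c \<otimes>\<^bsub>D\<^esub> b}"

definition fraction :: "('a, 'm) ring_scheme \<Rightarrow> 'a \<Rightarrow> 'a \<Rightarrow> ('a \<times> 'a) set"
  where "fraction D a b = frac_rel D `` {(a, b)}"

definition quotient_field :: "('a, 'm) ring_scheme \<Rightarrow> ('a \<times> 'a) set ring"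
  where "quotient_field D =
    \<lparr>carrier = (carrier D \<times> (carrier D - {\<zero>\<^bsub>D\<^esub>})) // frac_rel D,
     monoid.mult = (\<lambda>A B. \<Union>(a, b)\<in>A. \<Union>(c, d)\<in>B. fraction D (a \<otimes>\<^bsub>D\<^esub> c) (b \<otimes>\<^bsub>D\<^esub> d)),
     monoid.one = fraction D \<one>\<^bsub>D\<^esub> \<one>\<^bsub>D\<^esub>,
     ring.zero = fraction D \<zero>\<^bsub>D\<^esub> \<one>\<^bsub>D\<^esub>,
     ring.add = (\<lambda>A B. \<Union>(a, b)\<in>A. \<Union>(c, d)\<in>B.
       fraction D (a \<otimes>\<^bsub>D\<^esub> d \<oplus>\<^bsub>D\<^esub> c \<otimes>\<^bsub>D\<^esub> b) (b \<otimes>\<^bsub>D\<^esub> d))\<rparr>"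

definition frac_emb :: "('a, 'm) ring_scheme \<Rightarrow> 'a \<Rightarrow> ('a \<times> 'a) set"
  where "frac_emb D a = fraction D a \<one>\<^bsub>D\<^esub>"

definition fractional_ideal :: "('a, 'm) ring_scheme \<Rightarrow> ('a \<times> 'a) set set \<Rightarrow> bool"
  where "fractional_ideal D J \<longleftrightarrow>
    additive_subgroup J (quotient_field D) \<and>
    (\<forall>a\<in>carrier D. \<forall>j\<in>J. frac_emb D a \<otimes>\<^bsub>quotient_field D\<^esub> j \<in> J) \<and>
    (\<exists>d\<in>carrier D - {\<zero>\<^bsub>D\<^esub>}. \<forall>j\<in>J.
      frac_emb D d \<otimes>\<^bsub>quotient_field D\<^esub> j \<in> frac_emb D ` carrier D)"

text \<open>The constant \<^const>\<open>ideal_prod\<close> merely forms the finite sums of products of elements of two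
  sets, so over the quotient field it yields the product of fractional ideals.\<close>

definition invertible_ideal :: "('a, 'm) ring_scheme \<Rightarrow> 'a set \<Rightarrow> bool"
  where "invertible_ideal D I \<longleftrightarrow>
    (\<exists>J. fractional_ideal D J \<and>
      ideal_prod (quotient_field D) (frac_emb D ` I) J = frac_emb D ` carrier D)"

definition pruefer_domain :: "('a, 'm) ring_scheme \<Rightarrow> bool"
  where "pruefer_domain D \<longleftrightarrow> domain D \<and>
    (\<forall>S. finite S \<and> S \<subseteq> carrier D \<and> genideal D S \<noteq> {\<zero>\<^bsub>D\<^esub>} \<longrightarrow> invertible_ideal D (genideal D S))"


section \<open>Localizations at maximal ideals, value groups and valuations\<close>

definition max_ideals :: "('a, 'm) ring_scheme \<Rightarrow> 'a set set"
  where "max_ideals D = {M. maximalideal M D}"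

definition localization :: "('a, 'm) ring_scheme \<Rightarrow> 'a set \<Rightarrow> ('a \<times> 'a) set set"
  where "localization D M = {fraction D a s | a s. a \<in> carrier D \<and> s \<in> carrier D - M}"

text \<open>Ordered abelian groups are written multiplicatively, as usual in this library: the neutral
  element \<^const>\<open>monoid.one\<close> plays the role of the zero of an additively written value group.\<close>

record 'g ordered_group = "'g monoid" +
  group_le :: "'g \<Rightarrow> 'g \<Rightarrow> bool"

datatype 'g with_infty = Val 'g | Infty

definition ext_le :: "'g ordered_group \<Rightarrow> 'g with_infty \<Rightarrow> 'g with_infty \<Rightarrow> bool"
  where "ext_le \<Gamma> g h \<longleftrightarrow>
    (case h of Infty \<Rightarrow> True
     | Val b \<Rightarrow> (case g of Infty \<Rightarrow> False | Val a \<Rightarrow> group_le \<Gamma> a b))"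

definition ext_positive :: "'g ordered_group \<Rightarrow> 'g with_infty set"
  where "ext_positive \<Gamma> =
    {g \<in> insert Infty (Val ` carrier \<Gamma>). ext_le \<Gamma> (Val \<one>\<^bsub>\<Gamma>\<^esub>) g \<and> g \<noteq> Val \<one>\<^bsub>\<Gamma>\<^esub>}"

text \<open>The value group of a valuation ring \<open>V\<close> of a field \<open>K\<close>: the group of units of \<open>K\<close> modulo the
  group of units of \<open>V\<close>, where the class of \<open>a\<close> is at most the class of \<open>b\<close> iff \<open>b / a \<in> V\<close>.
  The valuation is the residue class map. Up to an isomorphism of ordered groups this is the only
  valuation with valuation ring \<open>V\<close> and surjective onto its value group.\<close>

definition value_group :: "('k, 'm) ring_scheme \<Rightarrow> 'k set \<Rightarrow> 'k set ordered_group"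
  where "value_group K V =
    \<lparr>carrier = carrier (units_of K Mod Units (K\<lparr>carrier := V\<rparr>)),
     monoid.mult = monoid.mult (units_of K Mod Units (K\<lparr>carrier := V\<rparr>)),
     monoid.one = monoid.one (units_of K Mod Units (K\<lparr>carrier := V\<rparr>)),
     group_le = (\<lambda>A B. \<exists>a\<in>A. \<exists>b\<in>B. b \<otimes>\<^bsub>K\<^esub> inv\<^bsub>K\<^esub> a \<in> V)\<rparr>"

definition valuation_of :: "('k, 'm) ring_scheme \<Rightarrow> 'k set \<Rightarrow> 'k \<Rightarrow> 'k set with_infty"
  where "valuation_of K V k =
    (if k = \<zero>\<^bsub>K\<^esub> then Infty else Val (Units (K\<lparr>carrier := V\<rparr>) #>\<^bsub>units_of K\<^esub> k))"

definition max_value_group ::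
    "('a, 'm) ring_scheme \<Rightarrow> 'a set \<Rightarrow> ('a \<times> 'a) set set ordered_group"
  where "max_value_group D M = value_group (quotient_field D) (localization D M)"

definition max_valuation ::
    "('a, 'm) ring_scheme \<Rightarrow> 'a set \<Rightarrow> ('a \<times> 'a) set \<Rightarrow> ('a \<times> 'a) set set with_infty"
  where "max_valuation D M = valuation_of (quotient_field D) (localization D M)"


section \<open>Products, ultrafilters and ultraproducts\<close>

definition product_ring :: "'i set \<Rightarrow> ('i \<Rightarrow> ('a, 'm) ring_scheme) \<Rightarrow> ('i \<Rightarrow> 'a) ring"
  where "product_ring I A =
    \<lparr>carrier = (\<Pi>\<^sub>E i\<in>I. carrier (A i)),
     monoid.mult = (\<lambda>f g. \<lambda>i\<in>I. f i \<otimes>\<^bsub>A i\<^esub> g i),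
     monoid.one = (\<lambda>i\<in>I. \<one>\<^bsub>A i\<^esub>),
     ring.zero = (\<lambda>i\<in>I. \<zero>\<^bsub>A i\<^esub>),
     ring.add = (\<lambda>f g. \<lambda>i\<in>I. f i \<oplus>\<^bsub>A i\<^esub> g i)\<rparr>"

definition ultrafilter_on :: "'x set \<Rightarrow> 'x set set \<Rightarrow> bool"
  where "ultrafilter_on S \<U> \<longleftrightarrow>
    \<U> \<subseteq> Pow S \<and> S \<in> \<U> \<and> {} \<notin> \<U> \<and>
    (\<forall>A\<in>\<U>. \<forall>B\<in>\<U>. A \<inter> B \<in> \<U>) \<and>
    (\<forall>A\<in>\<U>. \<forall>B. A \<subseteq> B \<and> B \<subseteq> S \<longrightarrow> B \<in> \<U>) \<and>
    (\<forall>A. A \<subseteq> S \<longrightarrow> A \<in> \<U> \<or> S - A \<in> \<U>)"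

definition ultra_rel :: "'i set \<Rightarrow> 'i set set \<Rightarrow> ('i \<Rightarrow> 'b set) \<Rightarrow> (('i \<Rightarrow> 'b) \<times> ('i \<Rightarrow> 'b)) set"
  where "ultra_rel I \<U> S =
    {(f, g). f \<in> Pi\<^sub>E I S \<and> g \<in> Pi\<^sub>E I S \<and> {i \<in> I. f i = g i} \<in> \<U>}"

definition ultra_class :: "'i set \<Rightarrow> 'i set set \<Rightarrow> ('i \<Rightarrow> 'b set) \<Rightarrow> ('i \<Rightarrow> 'b) \<Rightarrow> ('i \<Rightarrow> 'b) set"
  where "ultra_class I \<U> S f = ultra_rel I \<U> S `` {f}"

definition ultraproduct_ring ::
    "'i set \<Rightarrow> 'i set set \<Rightarrow> ('i \<Rightarrow> ('a, 'm) ring_scheme) \<Rightarrow> ('i \<Rightarrow> 'a) set ring"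
  where "ultraproduct_ring I \<U> A =
    (let cl = ultra_class I \<U> (\<lambda>i. carrier (A i)) in
    \<lparr>carrier = (\<Pi>\<^sub>E i\<in>I. carrier (A i)) // ultra_rel I \<U> (\<lambda>i. carrier (A i)),
     monoid.mult = (\<lambda>F G. \<Union>f\<in>F. \<Union>g\<in>G. cl (\<lambda>i\<in>I. f i \<otimes>\<^bsub>A i\<^esub> g i)),
     monoid.one = cl (\<lambda>i\<in>I. \<one>\<^bsub>A i\<^esub>),
     ring.zero = cl (\<lambda>i\<in>I. \<zero>\<^bsub>A i\<^esub>),
     ring.add = (\<lambda>F G. \<Union>f\<in>F. \<Union>g\<in>G. cl (\<lambda>i\<in>I. f i \<oplus>\<^bsub>A i\<^esub> g i))\<rparr>)"

definition ultraproduct_group ::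
    "'i set \<Rightarrow> 'i set set \<Rightarrow> ('i \<Rightarrow> 'g ordered_group) \<Rightarrow> ('i \<Rightarrow> 'g) set ordered_group"
  where "ultraproduct_group I \<U> A =
    (let cl = ultra_class I \<U> (\<lambda>i. carrier (A i)) in
    \<lparr>carrier = (\<Pi>\<^sub>E i\<in>I. carrier (A i)) // ultra_rel I \<U> (\<lambda>i. carrier (A i)),
     monoid.mult = (\<lambda>F G. \<Union>f\<in>F. \<Union>g\<in>G. cl (\<lambda>i\<in>I. f i \<otimes>\<^bsub>A i\<^esub> g i)),
     monoid.one = cl (\<lambda>i\<in>I. \<one>\<^bsub>A i\<^esub>),
     group_le = (\<lambda>F G. \<exists>f\<in>F. \<exists>g\<in>G. {i \<in> I. group_le (A i) (f i) (g i)} \<in> \<U>)\<rparr>)"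


section \<open>The valuation on the ultraproduct of the quotient fields\<close>

definition max_union :: "'i set \<Rightarrow> ('i \<Rightarrow> ('a, 'm) ring_scheme) \<Rightarrow> ('i \<times> 'a set) set"
  where "max_union \<Lambda> D = (SIGMA l:\<Lambda>. max_ideals (D l))"

definition index_filter ::
    "'i set \<Rightarrow> ('i \<Rightarrow> ('a, 'm) ring_scheme) \<Rightarrow> ('i \<times> 'a set) set set \<Rightarrow> 'i set set"
  where "index_filter \<Lambda> D \<U> =
    {{l \<in> \<Lambda>. \<exists>M\<in>max_ideals (D l). (l, M) \<in> U} | U. U \<in> \<U>}"

definition ultra_R ::
    "'i set \<Rightarrow> ('i \<Rightarrow> ('a, 'm) ring_scheme) \<Rightarrow> ('i \<times> 'a set) set set \<Rightarrow> ('i \<Rightarrow> 'a) set ring"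
  where "ultra_R \<Lambda> D \<U> = ultraproduct_ring \<Lambda> (index_filter \<Lambda> D \<U>) D"

definition star ::
    "'i set \<Rightarrow> ('i \<Rightarrow> ('a, 'm) ring_scheme) \<Rightarrow> ('i \<times> 'a set) set set \<Rightarrow> ('i \<Rightarrow> 'a) \<Rightarrow> ('i \<Rightarrow> 'a) set"
  where "star \<Lambda> D \<U> x = ultra_class \<Lambda> (index_filter \<Lambda> D \<U>) (\<lambda>l. carrier (D l)) x"

definition ultra_K ::
    "'i set \<Rightarrow> ('i \<Rightarrow> ('a, 'm) ring_scheme) \<Rightarrow> ('i \<times> 'a set) set set
      \<Rightarrow> ('i \<Rightarrow> ('a \<times> 'a) set) set ring"
  where "ultra_K \<Lambda> D \<U> =
    ultraproduct_ring \<Lambda> (index_filter \<Lambda> D \<U>) (\<lambda>l. quotient_field (D l))"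

text \<open>The embedding of the ultraproduct of the domains into that of their quotient fields.\<close>

definition ultra_emb ::
    "'i set \<Rightarrow> ('i \<Rightarrow> ('a, 'm) ring_scheme) \<Rightarrow> ('i \<times> 'a set) set set
      \<Rightarrow> ('i \<Rightarrow> 'a) set \<Rightarrow> ('i \<Rightarrow> ('a \<times> 'a) set) set"
  where "ultra_emb \<Lambda> D \<U> F =
    (\<Union>f\<in>F. ultra_class \<Lambda> (index_filter \<Lambda> D \<U>) (\<lambda>l. carrier (quotient_field (D l)))
      (\<lambda>l\<in>\<Lambda>. frac_emb (D l) (f l)))"

definition ultra_value_group ::
    "'i set \<Rightarrow> ('i \<Rightarrow> ('a, 'm) ring_scheme) \<Rightarrow> ('i \<times> 'a set) set set
      \<Rightarrow> ('i \<times> 'a set \<Rightarrow> ('a \<times> 'a) set set) set ordered_group"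
  where "ultra_value_group \<Lambda> D \<U> =
    ultraproduct_group (max_union \<Lambda> D) \<U> (\<lambda>p. max_value_group (D (fst p)) (snd p))"

text \<open>A representative \<open>k\<close> of a non-zero class may still vanish at some indices, so that the family
  of the values of its components is a family of group elements only on some member of the
  ultrafilter. Its class therefore consists of all families of group elements agreeing with it on
  some member of the ultrafilter.\<close>

definition ultra_valuation ::
    "'i set \<Rightarrow> ('i \<Rightarrow> ('a, 'm) ring_scheme) \<Rightarrow> ('i \<times> 'a set) set set
      \<Rightarrow> ('i \<Rightarrow> ('a \<times> 'a) set) set \<Rightarrow> ('i \<times> 'a set \<Rightarrow> ('a \<times> 'a) set set) set with_infty"
  where "ultra_valuation \<Lambda> D \<U> F =
    (if F = \<zero>\<^bsub>ultra_K \<Lambda> D \<U>\<^esub> then Infty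
     else Val (\<Union>k\<in>F.
       {\<gamma> \<in> (\<Pi>\<^sub>E p\<in>max_union \<Lambda> D. carrier (max_value_group (D (fst p)) (snd p))).
         {p \<in> max_union \<Lambda> D. max_valuation (D (fst p)) (snd p) (k (fst p)) = Val (\<gamma> p)} \<in> \<U>}))"

definition ultra_ideal ::
    "'i set \<Rightarrow> ('i \<Rightarrow> ('a, 'm) ring_scheme) \<Rightarrow> ('i \<times> 'a set) set set
      \<Rightarrow> ('i \<times> 'a set \<Rightarrow> ('a \<times> 'a) set set) set with_infty \<Rightarrow> ('i \<Rightarrow> 'a) set"
  where "ultra_ideal \<Lambda> D \<U> g =
    {x \<in> carrier (product_ring \<Lambda> D). \<exists>n::nat.
      ext_le (ultra_value_group \<Lambda> D \<U>) g
        (ultra_valuation \<Lambda> D \<U>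
          (ultra_emb \<Lambda> D \<U> (star \<Lambda> D \<U> x [^]\<^bsub>ultra_R \<Lambda> D \<U>\<^esub> n)))}"

end

theory Submission
  imports Defs
begin

text \<open>Localizing at a maximal ideal \<open>M\<close> turns statements about values into divisibility:
  \<open>v\<^sub>M(x) \<le> v\<^sub>M(y)\<close> iff \<open>s y = x c\<close> for some \<open>s \<notin> M\<close> and \<open>c\<close>. An element \<open>g\<close> of the extended
  ultraproduct of the value groups is then a family of quotients \<open>a / b\<close>, and \<open>(\<U>)\<^sup>g\<close> consists of
  the \<open>x\<close> for which some \<open>n\<close> satisfies \<open>v(a) \<le> v(x\<^sup>n b)\<close> on a member of \<open>\<U>\<close>. Since these
  valuations are total preorders, so is their ultraproduct; hence each \<open>(\<U>)\<^sup>g\<close> is prime, and for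
  fixed \<open>\<U>\<close> they form a chain.

  Conversely, let \<open>P\<close> be prime. Finitely many elements of \<open>P\<close> have a common maximal ideal in
  some component, for otherwise they would generate the unit ideal in every component and hence
  in the product. So the sets \<open>{M. x\<^sub>\<lambda> \<in> M}\<close> with \<open>x \<in> P\<close> lie in an ultrafilter \<open>\<U>\<close>. Any such
  \<open>\<U>\<close> works, and \<open>P\<close> is the union of the \<open>(\<U>)\<^sup>g\<close> over the values \<open>g = v(x)\<close> with \<open>x \<in> P\<close>: in a
  Pruefer domain there are \<open>a, c, d\<close> with \<open>a w = x c\<close> and \<open>(1 - a) x = w d\<close>, and \<open>v(w) > v(x)\<close>
  forces \<open>a \<notin> M\<close>.\<close>

section \<open>Quotient fields\<close>

text \<open>The obstacle is that the ultrafilter lives on X, while an element of R has only one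
  component for each index: choices made separately at the maximal ideals of a single component do
  not define an element of R. The Pruefer property is therefore used inside each component and not
  only through its localizations. Writing 1 = x \<alpha> + w \<beta> with \<alpha>, \<beta> in the
  inverse of the ideal (x, w) yields one element a = x \<alpha> that serves all maximal ideals M at
  once: a and 1 - a = w \<beta> cannot both lie in M, and whichever is outside M decides a
  comparison of the two values there. When the values are equal, a may still lie in M, so the
  converse needs a strict inequality. Squaring an element with v(z) at least v(x) > 0 provides it,
  and a prime ideal cannot tell z from its square. The powers in the definition of the ideals have
  the matching purpose: they turn the set of elements of value at least g into its radical, and for
  a total preorder of values such a radical is prime. The exponent 0 never qualifies, because v(1) =
  0 < g.\<close>

lemma (in domain) fraction_eq_iff:
  assumes "a \<in> carrier R" "b \<in> carrier R - {\<zero>}" "c \<in> carrier R" "d \<in> carrier R - {\<zero>}"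
  shows "fraction R a b = fraction R c d \<longleftrightarrow> a \<otimes> d = c \<otimes> b"
proof
  assume "fraction R a b = fraction R c d"
  moreover have "(c, d) \<in> fraction R c d"
    using assms by (auto simp: fraction_def frac_rel_def)
  ultimately have "(c, d) \<in> fraction R a b"
    by simp
  then show "a \<otimes> d = c \<otimes> b"
    by (simp add: fraction_def frac_rel_def)
next
  \<comment> \<open>Inclusion of the classes is transitivity of cross-multiplication. The factor
    \<open>y\<close> has to be cancelled, and this is where a domain is needed.\<close>
  have sub: "fraction R x y \<subseteq> fraction R u v"
    if x: "x \<in> carrier R" and y: "y \<in> carrier R - {\<zero>}" and u: "u \<in> carrier R"
      and v: "v \<in> carrier R - {\<zero>}" and eq: "x \<otimes> v = u \<otimes> y" for x y u v
  proof
    fix p assume "p \<in> fraction R x y"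
    then obtain e f where p: "p = (e, f)" and ef: "e \<in> carrier R" "f \<in> carrier R - {\<zero>}"
        "x \<otimes> f = e \<otimes> y"
      by (auto simp: fraction_def frac_rel_def)
    have "y \<otimes> (u \<otimes> f) = (u \<otimes> y) \<otimes> f"
      using y u ef by (simp add: m_ac)
    also have "\<dots> = (x \<otimes> f) \<otimes> v"
      unfolding eq[symmetric] using x v ef(1,2) by (simp add: m_ac)
    also have "\<dots> = y \<otimes> (e \<otimes> v)"
      unfolding ef(3) using y v ef(1,2) by (simp add: m_ac)
    finally have "u \<otimes> f = e \<otimes> v"
      using m_lcancel[of y "u \<otimes> f" "e \<otimes> v"] y u v ef by auto
    then show "p \<in> fraction R u v"
      using p ef u v by (simp add: fraction_def frac_rel_def)
  qed
  assume eq: "a \<otimes> d = c \<otimes> b"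
  show "fraction R a b = fraction R c d"
    using sub[OF assms eq] sub[OF assms(3,4,1,2) eq[symmetric]] by blast
qed

lemma (in domain) mem_fractionE:
  assumes "(c, d) \<in> fraction R a b" "a \<in> carrier R" "b \<in> carrier R - {\<zero>}"
  shows "c \<in> carrier R" "d \<in> carrier R - {\<zero>}" "a \<otimes> d = c \<otimes> b"
  using assms by (auto simp: fraction_def frac_rel_def)

lemma (in domain) self_mem_fraction:
  assumes "a \<in> carrier R" "b \<in> carrier R - {\<zero>}"
  shows "(a, b) \<in> fraction R a b"
  using assms by (simp add: fraction_def frac_rel_def)

lemma (in domain) carrier_quotient_field:
  "carrier (quotient_field R) = {fraction R a b | a b. a \<in> carrier R \<and> b \<in> carrier R - {\<zero>}}"
  by (auto simp: quotient_field_def quotient_def fraction_def)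

lemma (in domain) fraction_closed:
  assumes "a \<in> carrier R" "b \<in> carrier R - {\<zero>}"
  shows "fraction R a b \<in> carrier (quotient_field R)"
  using assms unfolding carrier_quotient_field by blast

lemma (in domain) nonzero_mult_closed:
  assumes "a \<in> carrier R - {\<zero>}" "b \<in> carrier R - {\<zero>}"
  shows "a \<otimes> b \<in> carrier R - {\<zero>}"
  using assms integral by auto

text \<open>The operations of \<open>quotient_field\<close> are unions over all pairs of
  representatives. Such a union collapses to a single class once the result is independent of the
  representatives.\<close>

lemma (in domain) UN_fraction2:
  assumes ab: "a \<in> carrier R" "b \<in> carrier R - {\<zero>}"
    and cd: "c \<in> carrier R" "d \<in> carrier R - {\<zero>}"
    and const: "\<And>a' b' c' d'. (a', b') \<in> fraction R a b \<Longrightarrow> (c', d') \<in> fraction R c d \<Longrightarrow>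
      f a' b' c' d' = f a b c d"
  shows "(\<Union>(a', b')\<in>fraction R a b. \<Union>(c', d')\<in>fraction R c d. f a' b' c' d') = f a b c d"
  using self_mem_fraction[OF ab] self_mem_fraction[OF cd] const by fast

lemma (in domain) mult_fraction:
  assumes ab: "a \<in> carrier R" "b \<in> carrier R - {\<zero>}"
    and cd: "c \<in> carrier R" "d \<in> carrier R - {\<zero>}"
  shows "fraction R a b \<otimes>\<^bsub>quotient_field R\<^esub> fraction R c d = fraction R (a \<otimes> c) (b \<otimes> d)"
proof -
  have "fraction R (a' \<otimes> c') (b' \<otimes> d') = fraction R (a \<otimes> c) (b \<otimes> d)"
    if "(a', b') \<in> fraction R a b" "(c', d') \<in> fraction R c d" for a' b' c' d'
  proof -
    note m = mem_fractionE[OF that(1) ab] mem_fractionE[OF that(2) cd]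
    have "a' \<otimes> c' \<otimes> (b \<otimes> d) = (a' \<otimes> b) \<otimes> (c' \<otimes> d)"
      using m(1,2,4,5) ab cd by (simp add: m_ac)
    also have "\<dots> = a \<otimes> c \<otimes> (b' \<otimes> d')"
      unfolding m(3)[symmetric] m(6)[symmetric] using m(1,2,4,5) ab cd by (simp add: m_ac)
    finally show ?thesis
      using m(1,2,4,5) ab cd nonzero_mult_closed by (subst fraction_eq_iff) auto
  qed
  then show ?thesis
    unfolding quotient_field_def
    using UN_fraction2[OF ab cd, where f = "\<lambda>a b c d. fraction R (a \<otimes> c) (b \<otimes> d)"] by simp
qed

lemma (in domain) add_fraction:
  assumes ab: "a \<in> carrier R" "b \<in> carrier R - {\<zero>}"
    and cd: "c \<in> carrier R" "d \<in> carrier R - {\<zero>}"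
  shows "fraction R a b \<oplus>\<^bsub>quotient_field R\<^esub> fraction R c d =
    fraction R (a \<otimes> d \<oplus> c \<otimes> b) (b \<otimes> d)"
proof -
  have "fraction R (a' \<otimes> d' \<oplus> c' \<otimes> b') (b' \<otimes> d') = fraction R (a \<otimes> d \<oplus> c \<otimes> b) (b \<otimes> d)"
    if "(a', b') \<in> fraction R a b" "(c', d') \<in> fraction R c d" for a' b' c' d'
  proof -
    note m = mem_fractionE[OF that(1) ab] mem_fractionE[OF that(2) cd]
    have "(a' \<otimes> d' \<oplus> c' \<otimes> b') \<otimes> (b \<otimes> d) =
        (a' \<otimes> b) \<otimes> (d' \<otimes> d) \<oplus> (c' \<otimes> d) \<otimes> (b' \<otimes> b)"
      using m(1,2,4,5) ab cd by (simp add: m_ac l_distr r_distr)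
    also have "\<dots> = (a \<otimes> d \<oplus> c \<otimes> b) \<otimes> (b' \<otimes> d')"
      unfolding m(3)[symmetric] m(6)[symmetric] using m(1,2,4,5) ab cd by (simp add: m_ac l_distr r_distr)
    finally show ?thesis
      using m(1,2,4,5) ab cd nonzero_mult_closed by (subst fraction_eq_iff) auto
  qed
  then show ?thesis
    unfolding quotient_field_def
    using UN_fraction2[OF ab cd,
        where f = "\<lambda>a b c d. fraction R (a \<otimes> d \<oplus> c \<otimes> b) (b \<otimes> d)"] by simp
qed

lemma (in domain) one_quotient_field: "\<one>\<^bsub>quotient_field R\<^esub> = fraction R \<one> \<one>"
  by (simp add: quotient_field_def)

lemma (in domain) zero_quotient_field: "\<zero>\<^bsub>quotient_field R\<^esub> = fraction R \<zero> \<one>"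
  by (simp add: quotient_field_def)

lemma (in domain) quotient_field_cases:
  assumes "x \<in> carrier (quotient_field R)"
  obtains a b where "x = fraction R a b" "a \<in> carrier R" "b \<in> carrier R - {\<zero>}"
  using assms unfolding carrier_quotient_field by blast

lemma (in domain) fraction_eq_zero_iff:
  assumes "a \<in> carrier R" "b \<in> carrier R - {\<zero>}"
  shows "fraction R a b = \<zero>\<^bsub>quotient_field R\<^esub> \<longleftrightarrow> a = \<zero>"
  unfolding zero_quotient_field using assms by (subst fraction_eq_iff) auto

lemma (in domain) cring_quotient_field: "cring (quotient_field R)"
proof -
  let ?K = "quotient_field R"
  note nz = nonzero_mult_closed
  have one: "\<one> \<in> carrier R - {\<zero>}"
    by simp
  have "abelian_group ?K"
  proof (rule abelian_groupI)
    fix x y assume "x \<in> carrier ?K" "y \<in> carrier ?K"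
    then obtain a b c d where x: "x = fraction R a b" "a \<in> carrier R" "b \<in> carrier R - {\<zero>}"
      and y: "y = fraction R c d" "c \<in> carrier R" "d \<in> carrier R - {\<zero>}"
      by (metis quotient_field_cases)
    show "x \<oplus>\<^bsub>?K\<^esub> y \<in> carrier ?K"
      unfolding x(1) y(1) add_fraction[OF x(2,3) y(2,3)]
      using x(2,3) y(2,3) nz by (intro fraction_closed) auto
    show "x \<oplus>\<^bsub>?K\<^esub> y = y \<oplus>\<^bsub>?K\<^esub> x"
      unfolding x(1) y(1) add_fraction[OF x(2,3) y(2,3)] add_fraction[OF y(2,3) x(2,3)]
      using x(2,3) y(2,3) by (simp add: m_comm a_comm)
    fix z assume "z \<in> carrier ?K"
    then obtain e f where z: "z = fraction R e f" "e \<in> carrier R" "f \<in> carrier R - {\<zero>}"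
      by (metis quotient_field_cases)
    have "b \<otimes> d \<in> carrier R - {\<zero>}" "d \<otimes> f \<in> carrier R - {\<zero>}"
      using nz x y z by auto
    then show "x \<oplus>\<^bsub>?K\<^esub> y \<oplus>\<^bsub>?K\<^esub> z = x \<oplus>\<^bsub>?K\<^esub> (y \<oplus>\<^bsub>?K\<^esub> z)"
      unfolding x(1) y(1) z(1) using x(2,3) y(2,3) z(2,3)
      by (simp add: add_fraction m_ac l_distr r_distr a_ac)
  next
    show "\<zero>\<^bsub>?K\<^esub> \<in> carrier ?K"
      unfolding zero_quotient_field by (rule fraction_closed[OF _ one]) simp
  next
    fix x assume "x \<in> carrier ?K"
    then obtain a b where x: "x = fraction R a b" "a \<in> carrier R" "b \<in> carrier R - {\<zero>}"
      by (metis quotient_field_cases)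
    show "\<zero>\<^bsub>?K\<^esub> \<oplus>\<^bsub>?K\<^esub> x = x"
      unfolding zero_quotient_field x(1) add_fraction[OF zero_closed one x(2,3)]
      using x(2,3) by simp
    have "fraction R (\<ominus> a) b \<oplus>\<^bsub>?K\<^esub> x = fraction R (\<ominus> a \<otimes> b \<oplus> a \<otimes> b) (b \<otimes> b)"
      unfolding x(1) using x(2,3) by (subst add_fraction) auto
    also have "\<dots> = \<zero>\<^bsub>?K\<^esub>"
      using x(2,3) nz by (subst fraction_eq_zero_iff) (auto simp: l_minus l_neg)
    finally show "\<exists>y\<in>carrier ?K. y \<oplus>\<^bsub>?K\<^esub> x = \<zero>\<^bsub>?K\<^esub>"
      using x(2,3) by (meson a_inv_closed fraction_closed)
  qed
  moreover have "comm_monoid ?K"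
  proof (rule comm_monoidI)
    fix x y assume "x \<in> carrier ?K" "y \<in> carrier ?K"
    then obtain a b c d where x: "x = fraction R a b" "a \<in> carrier R" "b \<in> carrier R - {\<zero>}"
      and y: "y = fraction R c d" "c \<in> carrier R" "d \<in> carrier R - {\<zero>}"
      by (metis quotient_field_cases)
    show "x \<otimes>\<^bsub>?K\<^esub> y \<in> carrier ?K"
      unfolding x(1) y(1) mult_fraction[OF x(2,3) y(2,3)]
      using x(2,3) y(2,3) nz by (intro fraction_closed) auto
    show "x \<otimes>\<^bsub>?K\<^esub> y = y \<otimes>\<^bsub>?K\<^esub> x"
      unfolding x(1) y(1) mult_fraction[OF x(2,3) y(2,3)] mult_fraction[OF y(2,3) x(2,3)]
      using x(2,3) y(2,3) by (simp add: m_comm)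
    fix z assume "z \<in> carrier ?K"
    then obtain e f where z: "z = fraction R e f" "e \<in> carrier R" "f \<in> carrier R - {\<zero>}"
      by (metis quotient_field_cases)
    have "b \<otimes> d \<in> carrier R - {\<zero>}" "d \<otimes> f \<in> carrier R - {\<zero>}"
      using nz x y z by auto
    then show "x \<otimes>\<^bsub>?K\<^esub> y \<otimes>\<^bsub>?K\<^esub> z = x \<otimes>\<^bsub>?K\<^esub> (y \<otimes>\<^bsub>?K\<^esub> z)"
      unfolding x(1) y(1) z(1) using x(2,3) y(2,3) z(2,3)
      by (simp add: mult_fraction m_ac)
  next
    show "\<one>\<^bsub>?K\<^esub> \<in> carrier ?K"
      unfolding one_quotient_field by (rule fraction_closed[OF _ one]) simp
  next
    fix x assume "x \<in> carrier ?K"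
    then obtain a b where x: "x = fraction R a b" "a \<in> carrier R" "b \<in> carrier R - {\<zero>}"
      by (metis quotient_field_cases)
    show "\<one>\<^bsub>?K\<^esub> \<otimes>\<^bsub>?K\<^esub> x = x"
      unfolding one_quotient_field x(1) mult_fraction[OF one_closed one x(2,3)]
      using x(2,3) by simp
  qed
  moreover have "(x \<oplus>\<^bsub>?K\<^esub> y) \<otimes>\<^bsub>?K\<^esub> z = x \<otimes>\<^bsub>?K\<^esub> z \<oplus>\<^bsub>?K\<^esub> y \<otimes>\<^bsub>?K\<^esub> z"
    if xyz: "x \<in> carrier ?K" "y \<in> carrier ?K" "z \<in> carrier ?K" for x y z
  proof -
    obtain a b c d e f where x: "x = fraction R a b" "a \<in> carrier R" "b \<in> carrier R - {\<zero>}"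
      and y: "y = fraction R c d" "c \<in> carrier R" "d \<in> carrier R - {\<zero>}"
      and z: "z = fraction R e f" "e \<in> carrier R" "f \<in> carrier R - {\<zero>}"
      using xyz by (metis quotient_field_cases)
    have n: "b \<otimes> d \<in> carrier R - {\<zero>}" "b \<otimes> f \<in> carrier R - {\<zero>}" "d \<otimes> f \<in> carrier R - {\<zero>}"
      using nz x y z by auto
    have m: "b \<otimes> d \<otimes> f \<in> carrier R - {\<zero>}" "b \<otimes> f \<otimes> (d \<otimes> f) \<in> carrier R - {\<zero>}"
      using nz n z by blast+
    have "(x \<oplus>\<^bsub>?K\<^esub> y) \<otimes>\<^bsub>?K\<^esub> z = fraction R ((a \<otimes> d \<oplus> c \<otimes> b) \<otimes> e) (b \<otimes> d \<otimes> f)"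
      unfolding x(1) y(1) z(1) using x(2,3) y(2,3) z(2,3) n
      by (simp add: add_fraction mult_fraction)
    \<comment> \<open>Adding the two products introduces an extra factor \<open>f\<close> above and
      below, so the two fractions are compared by cross-multiplication.\<close>
    also have "\<dots> = fraction R (a \<otimes> e \<otimes> (d \<otimes> f) \<oplus> c \<otimes> e \<otimes> (b \<otimes> f)) (b \<otimes> f \<otimes> (d \<otimes> f))"
      using x(2,3) y(2,3) z(2,3) n m
      by (subst fraction_eq_iff) (simp_all add: l_distr r_distr m_ac)
    also have "\<dots> = x \<otimes>\<^bsub>?K\<^esub> z \<oplus>\<^bsub>?K\<^esub> y \<otimes>\<^bsub>?K\<^esub> z"
      unfolding x(1) y(1) z(1) using x(2,3) y(2,3) z(2,3) n
      by (simp add: add_fraction mult_fraction)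
    finally show ?thesis .
  qed
  ultimately show ?thesis
    by (rule cringI)
qed

lemma (in domain) fraction_inverse:
  assumes "a \<in> carrier R - {\<zero>}" "b \<in> carrier R - {\<zero>}"
  shows "fraction R a b \<otimes>\<^bsub>quotient_field R\<^esub> fraction R b a = \<one>\<^bsub>quotient_field R\<^esub>"
proof -
  have "fraction R a b \<otimes>\<^bsub>quotient_field R\<^esub> fraction R b a = fraction R (a \<otimes> b) (b \<otimes> a)"
    using assms by (simp add: mult_fraction)
  also have "\<dots> = fraction R \<one> \<one>"
    using assms nonzero_mult_closed[of b a] by (subst fraction_eq_iff) (auto simp: m_comm)
  finally show ?thesis
    by (simp add: one_quotient_field)
qed

lemma (in domain) field_quotient_field: "field (quotient_field R)"
proof -
  interpret K: cring "quotient_field R"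
    by (rule cring_quotient_field)
  show ?thesis
  proof (rule K.cring_fieldI2)
    show "\<zero>\<^bsub>quotient_field R\<^esub> \<noteq> \<one>\<^bsub>quotient_field R\<^esub>"
      unfolding one_quotient_field using fraction_eq_zero_iff[of \<one> \<one>] by auto
    fix x assume "x \<in> carrier (quotient_field R)" "x \<noteq> \<zero>\<^bsub>quotient_field R\<^esub>"
    then obtain a b where x: "x = fraction R a b" "a \<in> carrier R - {\<zero>}" "b \<in> carrier R - {\<zero>}"
      using fraction_eq_zero_iff by (metis Diff_iff quotient_field_cases singletonD)
    then show "\<exists>y\<in>carrier (quotient_field R). x \<otimes>\<^bsub>quotient_field R\<^esub> y = \<one>\<^bsub>quotient_field R\<^esub>"
      using fraction_inverse[OF x(2,3)] fraction_closed[of b a] by auto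
  qed
qed

lemma (in domain) inv_fraction:
  assumes "a \<in> carrier R - {\<zero>}" "b \<in> carrier R - {\<zero>}"
  shows "inv\<^bsub>quotient_field R\<^esub> (fraction R a b) = fraction R b a"
proof -
  interpret K: field "quotient_field R"
    by (rule field_quotient_field)
  show ?thesis
    using fraction_inverse[OF assms] assms by (intro K.comm_inv_char fraction_closed) auto
qed

lemma (in domain) frac_emb_closed:
  "a \<in> carrier R \<Longrightarrow> frac_emb R a \<in> carrier (quotient_field R)"
  unfolding frac_emb_def by (rule fraction_closed) auto

lemma (in domain) frac_emb_eq_iff:
  "a \<in> carrier R \<Longrightarrow> b \<in> carrier R \<Longrightarrow> frac_emb R a = frac_emb R b \<longleftrightarrow> a = b"
  unfolding frac_emb_def by (subst fraction_eq_iff) auto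

lemma (in domain) frac_emb_eq_zero_iff:
  "a \<in> carrier R \<Longrightarrow> frac_emb R a = \<zero>\<^bsub>quotient_field R\<^esub> \<longleftrightarrow> a = \<zero>"
  unfolding frac_emb_def by (rule fraction_eq_zero_iff) auto

lemma (in domain) frac_emb_mult:
  "a \<in> carrier R \<Longrightarrow> b \<in> carrier R \<Longrightarrow>
    frac_emb R (a \<otimes> b) = frac_emb R a \<otimes>\<^bsub>quotient_field R\<^esub> frac_emb R b"
  unfolding frac_emb_def by (subst mult_fraction) auto

lemma (in domain) frac_emb_add:
  "a \<in> carrier R \<Longrightarrow> b \<in> carrier R \<Longrightarrow>
    frac_emb R (a \<oplus> b) = frac_emb R a \<oplus>\<^bsub>quotient_field R\<^esub> frac_emb R b"
  unfolding frac_emb_def by (subst add_fraction) auto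

section \<open>Value groups and divisibility in localizations\<close>

lemma (in field) Units_restrict_eq:
  assumes "V \<subseteq> carrier R"
  shows "Units (R\<lparr>carrier := V\<rparr>) = {u \<in> V. u \<noteq> \<zero> \<and> inv u \<in> V}"
proof (intro subset_antisym subsetI)
  fix u assume "u \<in> Units (R\<lparr>carrier := V\<rparr>)"
  then obtain w where w: "u \<in> V" "w \<in> V" "w \<otimes> u = \<one>" "u \<otimes> w = \<one>"
    by (auto simp: Units_def)
  then have "u \<in> carrier R" "w \<in> carrier R"
    using assms by auto
  moreover from this have "u \<noteq> \<zero>"
    using w(3) by auto
  ultimately show "u \<in> {u \<in> V. u \<noteq> \<zero> \<and> inv u \<in> V}"
    using w comm_inv_char[of u w] by simp
next
  fix u assume "u \<in> {u \<in> V. u \<noteq> \<zero> \<and> inv u \<in> V}"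
  then have u: "u \<in> V" "inv u \<in> V" "u \<in> Units R"
    using assms field_Units by auto
  then have "inv u \<otimes> u = \<one>" "u \<otimes> inv u = \<one>"
    by simp_all
  with u(2) have "\<exists>w\<in>V. w \<otimes> u = \<one> \<and> u \<otimes> w = \<one>"
    by blast
  then show "u \<in> Units (R\<lparr>carrier := V\<rparr>)"
    unfolding Units_def using u(1) by simp
qed

lemma (in comm_monoid) inv_mult_Units:
  assumes "u \<in> Units G" "k \<in> Units G"
  shows "inv (u \<otimes> k) = inv u \<otimes> inv k"
proof (rule comm_inv_char)
  have "u \<otimes> k \<otimes> (inv u \<otimes> inv k) = (u \<otimes> inv u) \<otimes> (k \<otimes> inv k)"
    using assms by (simp only: m_ac Units_closed Units_inv_closed m_closed)
  then show "u \<otimes> k \<otimes> (inv u \<otimes> inv k) = \<one>"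
    using assms by simp
qed (use assms Units_closed in simp_all)

text \<open>The value group and its order involve only products and inverses, so the valuation ring
  \<open>V\<close> enters as a multiplicative submonoid of the field.\<close>

locale submonoid_of_field = field R for R (structure) +
  fixes V
  assumes V_sub: "V \<subseteq> carrier R"
    and one_V: "\<one> \<in> V"
    and mult_V: "\<And>x y. x \<in> V \<Longrightarrow> y \<in> V \<Longrightarrow> x \<otimes> y \<in> V"
begin

abbreviation "U \<equiv> Units (R\<lparr>carrier := V\<rparr>)"
abbreviation coset where "coset k \<equiv> U #>\<^bsub>units_of R\<^esub> k"

lemma U_eq: "U = {u \<in> V. u \<noteq> \<zero> \<and> inv u \<in> V}"
  by (rule Units_restrict_eq[OF V_sub])

lemma mem_U_iff: "u \<in> U \<longleftrightarrow> u \<in> V \<and> u \<noteq> \<zero> \<and> inv u \<in> V"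
  unfolding U_eq by simp

lemma one_U: "\<one> \<in> U"
  unfolding mem_U_iff using one_V by simp

lemma U_Units: "u \<in> U \<Longrightarrow> u \<in> Units R"
  unfolding mem_U_iff field_Units using V_sub by blast

lemma units_carrier: "carrier (units_of R) = carrier R - {\<zero>}"
  by (simp add: units_of_carrier field_Units)

lemma subgroup_U: "subgroup U (units_of R)"
proof -
  interpret G: comm_group "units_of R"
    by (rule units_comm_group)
  show ?thesis
  proof (rule G.subgroupI)
    show "U \<subseteq> carrier (units_of R)"
      unfolding U_eq units_carrier using V_sub by blast
    show "U \<noteq> {}"
      using one_U by blast
    fix a assume a: "a \<in> U"
    note aU = U_Units[OF a]
    have "inv a \<noteq> \<zero>"
      using Units_inv_Units[OF aU] unfolding field_Units by blast
    then show "inv\<^bsub>units_of R\<^esub> a \<in> U"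
      using a aU unfolding mem_U_iff by (simp add: units_of_inv)
    fix b assume b: "b \<in> U"
    note bU = U_Units[OF b]
    have "a \<otimes> b \<noteq> \<zero>"
      using Units_m_closed[OF aU bU] unfolding field_Units by blast
    then show "a \<otimes>\<^bsub>units_of R\<^esub> b \<in> U"
      using a b mult_V unfolding mem_U_iff by (simp add: units_of_mult inv_mult_Units[OF aU bU])
  qed
qed

lemma carrier_value_group: "carrier (value_group R V) = coset ` (carrier R - {\<zero>})"
  by (auto simp: value_group_def FactGroup_def RCOSETS_def units_carrier)

lemma one_value_group: "\<one>\<^bsub>value_group R V\<^esub> = coset \<one>"
proof -
  interpret G: comm_group "units_of R"
    by (rule units_comm_group)
  have "U \<subseteq> carrier (units_of R)"
    by (rule subgroup.subset[OF subgroup_U])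
  then have "coset \<one> = U"
    using G.coset_mult_one by (simp add: units_of_one)
  then show ?thesis
    by (simp add: value_group_def FactGroup_def)
qed

lemma coset_eq: "coset k = {u \<otimes> k | u. u \<in> U}"
  by (auto simp: r_coset_def units_of_mult)

text \<open>Other representatives change the quotient by a unit of \<open>V\<close>; multiplying by
  the inverse of that unit stays in \<open>V\<close>. Hence the existential quantifiers in
  \<open>group_le\<close> may be tested on any pair of representatives.\<close>

lemma group_le_coset_iff:
  assumes k: "k \<in> carrier R - {\<zero>}" and l: "l \<in> carrier R - {\<zero>}"
  shows "group_le (value_group R V) (coset k) (coset l) \<longleftrightarrow> l \<otimes> inv k \<in> V"
proof
  note kl = assms[folded field_Units]
  assume "l \<otimes> inv k \<in> V"
  then have "(\<one> \<otimes> l) \<otimes> inv (\<one> \<otimes> k) \<in> V"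
    using k l by simp
  then show "group_le (value_group R V) (coset k) (coset l)"
    unfolding value_group_def coset_eq using one_U by auto
next
  note kl = assms[folded field_Units]
  assume "group_le (value_group R V) (coset k) (coset l)"
  then obtain u w where u: "u \<in> U" and w: "w \<in> U" and V: "w \<otimes> l \<otimes> inv (u \<otimes> k) \<in> V"
    unfolding value_group_def coset_eq by auto
  have uw: "u \<in> Units R" "w \<in> Units R"
    using u w U_Units by blast+
  have "inv (u \<otimes> k) = inv u \<otimes> inv k"
    using uw kl by (intro inv_mult_Units)
  then have "(inv w \<otimes> u) \<otimes> (w \<otimes> l \<otimes> inv (u \<otimes> k)) =
      (w \<otimes> inv w) \<otimes> ((u \<otimes> inv u) \<otimes> (l \<otimes> inv k))"
    using uw kl Units_closed Units_inv_closed by (simp only: m_ac Units_closed Units_inv_closed m_closed)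
  also have "\<dots> = l \<otimes> inv k"
    using uw kl by (simp add: Units_r_inv Units_closed)
  finally have "l \<otimes> inv k = (inv w \<otimes> u) \<otimes> (w \<otimes> l \<otimes> inv (u \<otimes> k))" ..
  then show "l \<otimes> inv k \<in> V"
    using u w V mult_V unfolding mem_U_iff by simp
qed

text \<open>Two cosets agree when the quotient is a unit of \<open>V\<close>, and a non-zero
  quotient is such a unit as soon as it and its inverse lie in \<open>V\<close>. Equality of values
  thus becomes inequality in both directions.\<close>

lemma coset_eq_iff:
  assumes k: "k \<in> carrier R - {\<zero>}" and l: "l \<in> carrier R - {\<zero>}"
  shows "coset k = coset l \<longleftrightarrow> l \<otimes> inv k \<in> V \<and> k \<otimes> inv l \<in> V"
proof
  have refl: "m \<otimes> inv m \<in> V" if "m \<in> carrier R - {\<zero>}" for m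
    using that one_V by (simp add: field_Units[symmetric])
  assume "coset k = coset l"
  then show "l \<otimes> inv k \<in> V \<and> k \<otimes> inv l \<in> V"
    using group_le_coset_iff[OF k l] group_le_coset_iff[OF l k] group_le_coset_iff[OF k k] refl[OF k]
    by simp
next
  interpret G: comm_group "units_of R"
    by (rule units_comm_group)
  note kl = assms[folded field_Units]
  assume V: "l \<otimes> inv k \<in> V \<and> k \<otimes> inv l \<in> V"
  have "inv (l \<otimes> inv k) = k \<otimes> inv l"
    using kl by (simp add: inv_mult_Units m_comm Units_closed)
  moreover have "l \<otimes> inv k \<noteq> \<zero>"
    using kl field_Units Units_m_closed[OF kl(2) Units_inv_Units[OF kl(1)]] by auto
  ultimately have "l \<otimes> inv k \<in> U"
    using V unfolding mem_U_iff by simp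
  moreover have "l = l \<otimes> inv k \<otimes> k"
    using kl by (simp add: m_assoc Units_closed)
  ultimately have "l \<in> coset k"
    unfolding coset_eq by blast
  then show "coset k = coset l"
    using G.repr_independence[OF _ _ subgroup_U] kl units_of_carrier by metis
qed

end

section \<open>Divisibility in the localization at a prime ideal\<close>

definition loc_dvd :: "('a, 'm) ring_scheme \<Rightarrow> 'a set \<Rightarrow> 'a \<Rightarrow> 'a \<Rightarrow> bool"
  where "loc_dvd D M x y \<longleftrightarrow> (\<exists>s\<in>carrier D - M. \<exists>c\<in>carrier D. s \<otimes>\<^bsub>D\<^esub> y = x \<otimes>\<^bsub>D\<^esub> c)"

definition frac_value :: "('a, 'm) ring_scheme \<Rightarrow> 'a set \<Rightarrow> 'a \<Rightarrow> 'a \<Rightarrow> ('a \<times> 'a) set set"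
  where "frac_value D M a b =
    Units (quotient_field D\<lparr>carrier := localization D M\<rparr>) #>\<^bsub>units_of (quotient_field D)\<^esub>
      fraction D a b"

text \<open>Maximal ideals are used here as prime ideals: primeness closes the complement of
  \<open>M\<close> under multiplication, so that denominators can be multiplied.\<close>

locale domain_prime = domain R + primeideal M R for R (structure) and M
begin

lemma one_notin: "\<one> \<notin> M"
  using I_notcarr one_imp_carrier by blast

lemma zero_in: "\<zero> \<in> M"
  by (rule additive_subgroup.zero_closed) (rule is_additive_subgroup)

lemma notin_nonzero: "s \<notin> M \<Longrightarrow> s \<noteq> \<zero>"
  using zero_in by blast

lemma notin_mult: "s \<in> carrier R - M \<Longrightarrow> t \<in> carrier R - M \<Longrightarrow> s \<otimes> t \<in> carrier R - M"
  using I_prime by auto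

lemma fraction_mem_localization_iff:
  assumes "a \<in> carrier R" "b \<in> carrier R - {\<zero>}"
  shows "fraction R a b \<in> localization R M \<longleftrightarrow> loc_dvd R M b a"
proof -
  have "fraction R a b = fraction R c s \<longleftrightarrow> s \<otimes> a = b \<otimes> c"
    if "c \<in> carrier R" "s \<in> carrier R - M" for c s
    using that assms notin_nonzero by (subst fraction_eq_iff) (auto simp: m_comm)
  then show ?thesis
    unfolding localization_def loc_dvd_def using assms(1) by blast
qed

lemma submonoid_of_field_localization: "submonoid_of_field (quotient_field R) (localization R M)"
proof -
  interpret K: field "quotient_field R"
    by (rule field_quotient_field)
  show ?thesis
  proof unfold_locales
    show "localization R M \<subseteq> carrier (quotient_field R)"
      unfolding localization_def carrier_quotient_field using notin_nonzero by blast
    show "\<one>\<^bsub>quotient_field R\<^esub> \<in> localization R M"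
      unfolding one_quotient_field localization_def using one_notin by blast
    fix x y assume "x \<in> localization R M" "y \<in> localization R M"
    then obtain a s b t where "x = fraction R a s" "y = fraction R b t" "a \<in> carrier R"
        "b \<in> carrier R" "s \<in> carrier R - M" "t \<in> carrier R - M"
      unfolding localization_def by auto
    moreover from this have "x \<otimes>\<^bsub>quotient_field R\<^esub> y = fraction R (a \<otimes> b) (s \<otimes> t)"
      using notin_nonzero by (simp add: mult_fraction)
    ultimately show "x \<otimes>\<^bsub>quotient_field R\<^esub> y \<in> localization R M"
      unfolding localization_def using notin_mult by blast
  qed
qed

sublocale V: submonoid_of_field "quotient_field R" "localization R M"
  by (rule submonoid_of_field_localization)

lemma fraction_nonzero:
  "a \<in> carrier R - {\<zero>} \<Longrightarrow> b \<in> carrier R - {\<zero>} \<Longrightarrow>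
    fraction R a b \<in> carrier (quotient_field R) - {\<zero>\<^bsub>quotient_field R\<^esub>}"
  using fraction_closed fraction_eq_zero_iff by auto

lemma carrier_max_value_group:
  "carrier (max_value_group R M) =
    {frac_value R M a b | a b. a \<in> carrier R - {\<zero>} \<and> b \<in> carrier R - {\<zero>}}"
proof -
  have "carrier (quotient_field R) - {\<zero>\<^bsub>quotient_field R\<^esub>} =
      {fraction R a b | a b. a \<in> carrier R - {\<zero>} \<and> b \<in> carrier R - {\<zero>}}"
    (is "?L = ?R")
  proof
    show "?L \<subseteq> ?R"
    proof
      fix x assume x: "x \<in> ?L"
      then obtain a b where "x = fraction R a b" "a \<in> carrier R" "b \<in> carrier R - {\<zero>}"
        by (metis DiffD1 quotient_field_cases)
      moreover from this have "a \<noteq> \<zero>"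
        using x fraction_eq_zero_iff by auto
      ultimately show "x \<in> ?R"
        by blast
    qed
    show "?R \<subseteq> ?L"
      using fraction_nonzero by blast
  qed
  then show ?thesis
    unfolding max_value_group_def V.carrier_value_group frac_value_def by auto
qed

lemma one_max_value_group: "\<one>\<^bsub>max_value_group R M\<^esub> = frac_value R M \<one> \<one>"
  unfolding max_value_group_def V.one_value_group frac_value_def one_quotient_field ..

lemma frac_value_closed:
  "a \<in> carrier R - {\<zero>} \<Longrightarrow> b \<in> carrier R - {\<zero>} \<Longrightarrow> frac_value R M a b \<in> carrier (max_value_group R M)"
  unfolding carrier_max_value_group by blast

lemma max_valuation_fraction:
  assumes "a \<in> carrier R" "b \<in> carrier R - {\<zero>}"
  shows "max_valuation R M (fraction R a b) =
    (if a = \<zero> then Infty else Val (frac_value R M a b))"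
  unfolding max_valuation_def valuation_of_def frac_value_def
  using assms by (simp add: fraction_eq_zero_iff)

lemma fraction_quotient_mem_localization_iff:
  assumes "a \<in> carrier R - {\<zero>}" "b \<in> carrier R - {\<zero>}"
    and "c \<in> carrier R - {\<zero>}" "d \<in> carrier R - {\<zero>}"
  shows "fraction R c d \<otimes>\<^bsub>quotient_field R\<^esub> inv\<^bsub>quotient_field R\<^esub> fraction R a b
      \<in> localization R M \<longleftrightarrow> loc_dvd R M (a \<otimes> d) (c \<otimes> b)"
proof -
  have "d \<otimes> a \<in> carrier R - {\<zero>}"
    using assms nonzero_mult_closed by blast
  then show ?thesis
    using assms
    by (simp add: inv_fraction mult_fraction fraction_mem_localization_iff m_comm[of d a])
qed

text \<open>Clearing denominators moves the comparison of v(a/b) with v(c/d) from the quotient field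
  into the domain itself.\<close>

lemma group_le_frac_value_iff:
  assumes "a \<in> carrier R - {\<zero>}" "b \<in> carrier R - {\<zero>}"
    and "c \<in> carrier R - {\<zero>}" "d \<in> carrier R - {\<zero>}"
  shows "group_le (max_value_group R M) (frac_value R M a b) (frac_value R M c d) \<longleftrightarrow>
    loc_dvd R M (a \<otimes> d) (c \<otimes> b)"
  unfolding max_value_group_def frac_value_def
  using V.group_le_coset_iff[OF fraction_nonzero fraction_nonzero, OF assms]
    fraction_quotient_mem_localization_iff[OF assms] by blast

lemma frac_value_eq_iff:
  assumes "a \<in> carrier R - {\<zero>}" "b \<in> carrier R - {\<zero>}"
    and "c \<in> carrier R - {\<zero>}" "d \<in> carrier R - {\<zero>}"
  shows "frac_value R M a b = frac_value R M c d \<longleftrightarrow>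
    loc_dvd R M (a \<otimes> d) (c \<otimes> b) \<and> loc_dvd R M (c \<otimes> b) (a \<otimes> d)"
  unfolding frac_value_def
  using V.coset_eq_iff[OF fraction_nonzero fraction_nonzero, OF assms]
    fraction_quotient_mem_localization_iff[OF assms]
    fraction_quotient_mem_localization_iff[OF assms(3,4,1,2)] by blast

lemma loc_dvd_refl: "x \<in> carrier R \<Longrightarrow> loc_dvd R M x x"
  unfolding loc_dvd_def using one_notin by (intro bexI[of _ \<one>]) auto

lemma loc_dvd_zero: "x \<in> carrier R \<Longrightarrow> loc_dvd R M x \<zero>"
  unfolding loc_dvd_def using one_notin by (intro bexI[of _ \<one>] bexI[of _ \<zero>]) auto

text \<open>Zero behaves as an element of value \<infinity>, which is why a numerator 0 can later
  stand for g = \<infinity>.\<close>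

lemma loc_dvd_zero_left_iff:
  assumes "x \<in> carrier R"
  shows "loc_dvd R M \<zero> x \<longleftrightarrow> x = \<zero>"
proof
  assume "loc_dvd R M \<zero> x"
  then obtain s where "s \<in> carrier R - M" "s \<otimes> x = \<zero>"
    unfolding loc_dvd_def by auto
  then show "x = \<zero>"
    using assms integral notin_nonzero by auto
qed (use loc_dvd_zero in auto)

lemma loc_dvd_mult_right:
  assumes "loc_dvd R M x y" "x \<in> carrier R" "y \<in> carrier R" "z \<in> carrier R"
  shows "loc_dvd R M x (y \<otimes> z)"
proof -
  obtain s c where s: "s \<in> carrier R - M" "c \<in> carrier R" "s \<otimes> y = x \<otimes> c"
    using assms unfolding loc_dvd_def by auto
  then have "s \<otimes> (y \<otimes> z) = x \<otimes> (c \<otimes> z)"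
    using assms by (metis DiffD1 m_assoc)
  then show ?thesis
    unfolding loc_dvd_def using s assms by blast
qed

lemma loc_dvd_trans:
  assumes "loc_dvd R M x y" "loc_dvd R M y z"
    and "x \<in> carrier R" "y \<in> carrier R" "z \<in> carrier R"
  shows "loc_dvd R M x z"
proof -
  obtain s c where s: "s \<in> carrier R - M" "c \<in> carrier R" "s \<otimes> y = x \<otimes> c"
    using assms unfolding loc_dvd_def by auto
  obtain t d where t: "t \<in> carrier R - M" "d \<in> carrier R" "t \<otimes> z = y \<otimes> d"
    using assms unfolding loc_dvd_def by auto
  have "(s \<otimes> t) \<otimes> z = s \<otimes> (y \<otimes> d)"
    using s(1,2) t assms by (simp add: m_assoc)
  also have "\<dots> = (s \<otimes> y) \<otimes> d"
    using s(1,2) t(1,2) assms by (simp add: m_assoc)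
  also have "\<dots> = x \<otimes> (c \<otimes> d)"
    unfolding s(3) using s(1,2) t(1,2) assms by (simp add: m_assoc)
  finally show ?thesis
    unfolding loc_dvd_def using notin_mult[OF s(1) t(1)] s t by blast
qed

lemma loc_dvd_mult:
  assumes "loc_dvd R M x y" "loc_dvd R M z w"
    and "x \<in> carrier R" "y \<in> carrier R" "z \<in> carrier R" "w \<in> carrier R"
  shows "loc_dvd R M (x \<otimes> z) (y \<otimes> w)"
proof -
  obtain s c where s: "s \<in> carrier R - M" "c \<in> carrier R" "s \<otimes> y = x \<otimes> c"
    using assms unfolding loc_dvd_def by auto
  obtain t d where t: "t \<in> carrier R - M" "d \<in> carrier R" "t \<otimes> w = z \<otimes> d"
    using assms unfolding loc_dvd_def by auto
  have "(s \<otimes> t) \<otimes> (y \<otimes> w) = (s \<otimes> y) \<otimes> (t \<otimes> w)"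
    using s(1,2) t(1,2) assms by (simp add: m_ac)
  also have "\<dots> = (x \<otimes> z) \<otimes> (c \<otimes> d)"
    unfolding s(3) t(3) using s(1,2) t(1,2) assms by (simp add: m_ac)
  finally show ?thesis
    unfolding loc_dvd_def using notin_mult[OF s(1) t(1)] s t by blast
qed

lemma loc_dvd_pow:
  assumes "loc_dvd R M x y" "x \<in> carrier R" "y \<in> carrier R"
  shows "loc_dvd R M (x [^] (n::nat)) (y [^] n)"
  using assms by (induction n) (auto intro: loc_dvd_refl loc_dvd_mult)

text \<open>The ultrametric inequality, in the case where \<open>x\<close> has the smaller
  value.\<close>

lemma loc_dvd_add:
  assumes "loc_dvd R M x y" "x \<in> carrier R" "y \<in> carrier R"
  shows "loc_dvd R M x (x \<oplus> y)"
proof -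
  obtain s c where s: "s \<in> carrier R - M" "c \<in> carrier R" "s \<otimes> y = x \<otimes> c"
    using assms unfolding loc_dvd_def by auto
  then have "s \<otimes> (x \<oplus> y) = x \<otimes> (s \<oplus> c)"
    using assms by (simp add: r_distr m_comm)
  then show ?thesis
    unfolding loc_dvd_def using s by blast
qed

lemma loc_dvd_cancel:
  assumes "loc_dvd R M (x \<otimes> z) (y \<otimes> z)"
    and "x \<in> carrier R" "y \<in> carrier R" "z \<in> carrier R - {\<zero>}"
  shows "loc_dvd R M x y"
proof -
  obtain s c where s: "s \<in> carrier R - M" "c \<in> carrier R" "s \<otimes> (y \<otimes> z) = (x \<otimes> z) \<otimes> c"
    using assms unfolding loc_dvd_def by auto
  then have "z \<otimes> (s \<otimes> y) = z \<otimes> (x \<otimes> c)"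
    using assms(2-) by (simp add: m_ac)
  then have "s \<otimes> y = x \<otimes> c"
    using m_lcancel[of z "s \<otimes> y" "x \<otimes> c"] s assms(2-) by auto
  then show ?thesis
    unfolding loc_dvd_def using s by blast
qed

text \<open>The value of \<open>x\<close> is positive precisely when \<open>x\<close> lies in
  \<open>M\<close>. This links membership in the maximal ideals to the condition g > 0.\<close>

lemma loc_dvd_one_iff: "x \<in> carrier R \<Longrightarrow> loc_dvd R M x \<one> \<longleftrightarrow> x \<notin> M"
proof
  assume x: "x \<in> carrier R"
  assume "loc_dvd R M x \<one>"
  then obtain s c where "s \<in> carrier R - M" "c \<in> carrier R" "s = x \<otimes> c"
    unfolding loc_dvd_def by auto
  then show "x \<notin> M"
    using x I_r_closed by auto
next
  assume "x \<in> carrier R" "x \<notin> M"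
  then show "loc_dvd R M x \<one>"
    unfolding loc_dvd_def by (intro bexI[of _ x] bexI[of _ \<one>]) auto
qed

end

text \<open>The sum of the principal ideal of \<open>x\<close> and \<open>Idl S\<close> is an ideal
  containing \<open>insert x S\<close>, so it contains the ideal generated by that set. This serves
  for two generators in a Pruefer domain, and as an induction step for finitely many generators in
  the components of the product.\<close>

lemma (in cring) mem_genideal_insertE:
  assumes "a \<in> Idl (insert x S)" "x \<in> carrier R" "S \<subseteq> carrier R"
  obtains r s where "r \<in> carrier R" "s \<in> Idl S" "a = r \<otimes> x \<oplus> s"
proof -
  interpret I: ideal "PIdl x" R
    by (rule cgenideal_ideal[OF assms(2)])
  interpret J: ideal "Idl S" R
    by (rule genideal_ideal[OF assms(3)])
  have "insert x S \<subseteq> PIdl x <+> Idl S"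
  proof
    fix y assume "y \<in> insert x S"
    then consider "y = x" | "y \<in> S"
      by blast
    then show "y \<in> PIdl x <+> Idl S"
    proof cases
      case 1
      then have "y = x \<oplus> \<zero>"
        using assms(2) by simp
      then show ?thesis
        using cgenideal_self[OF assms(2)] J.zero_closed unfolding set_add_def' by blast
    next
      case 2
      then have "y = \<zero> \<oplus> y"
        using assms(3) by auto
      then show ?thesis
        using genideal_self[OF assms(3)] 2 I.zero_closed unfolding set_add_def' by blast
    qed
  qed
  then have "Idl (insert x S) \<subseteq> PIdl x <+> Idl S"
    by (intro genideal_minimal add_ideals I.ideal_axioms J.ideal_axioms)
  then show ?thesis
    using assms(1) that unfolding set_add_def' cgenideal_def by blast
qed

section \<open>Comparing two elements of a Pruefer domain\<close>

locale pruefer = domain R for R (structure) +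
  assumes pruefer: "pruefer_domain R"
begin

text \<open>Elements of \<open>ideal_prod\<close> are sums of arbitrarily many products. The
  coefficients of the first factor over \<open>x\<close> and \<open>y\<close> can be absorbed into
  \<open>J\<close>, which is closed under multiplication by the domain, so collecting by generators
  leaves two terms.\<close>

lemma genideal_pair_mem_prod:
  assumes J: "fractional_ideal R J" and xy: "x \<in> carrier R" "y \<in> carrier R"
    and e: "e \<in> ideal_prod (quotient_field R) (frac_emb R ` (Idl {x, y})) J"
  shows "\<exists>\<alpha>\<in>J. \<exists>\<beta>\<in>J. e = frac_emb R x \<otimes>\<^bsub>quotient_field R\<^esub> \<alpha>
    \<oplus>\<^bsub>quotient_field R\<^esub> frac_emb R y \<otimes>\<^bsub>quotient_field R\<^esub> \<beta>"
  using e
proof induction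
  let ?K = "quotient_field R"
  interpret K: field ?K
    by (rule field_quotient_field)
  interpret J: additive_subgroup J ?K
    using J by (simp add: fractional_ideal_def)
  have emb: "frac_emb R a \<in> carrier ?K" if "a \<in> carrier R" for a
    using that by (rule frac_emb_closed)
  case (prod i j)
  then have jK: "j \<in> carrier ?K"
    using J.a_subset by blast
  obtain a where a: "a \<in> Idl {x, y}" "i = frac_emb R a"
    using prod by auto
  obtain r t where r: "r \<in> carrier R" "t \<in> Idl {y}" "a = r \<otimes> x \<oplus> t"
    using mem_genideal_insertE[OF a(1)] xy by blast
  moreover obtain s where "s \<in> carrier R" "t = s \<otimes> y"
    using r(2) cgenideal_eq_genideal[OF xy(2)] unfolding cgenideal_def by blast
  ultimately have rs: "r \<in> carrier R" "s \<in> carrier R" "a = r \<otimes> x \<oplus> s \<otimes> y"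
    by simp_all
  have "i \<otimes>\<^bsub>?K\<^esub> j = frac_emb R x \<otimes>\<^bsub>?K\<^esub> (frac_emb R r \<otimes>\<^bsub>?K\<^esub> j)
      \<oplus>\<^bsub>?K\<^esub> frac_emb R y \<otimes>\<^bsub>?K\<^esub> (frac_emb R s \<otimes>\<^bsub>?K\<^esub> j)"
    unfolding a(2) rs(3) using rs(1,2) xy jK
    by (simp add: frac_emb_add frac_emb_mult emb K.l_distr K.r_distr K.m_ac)
  moreover have "frac_emb R r \<otimes>\<^bsub>?K\<^esub> j \<in> J" "frac_emb R s \<otimes>\<^bsub>?K\<^esub> j \<in> J"
    using J rs prod by (auto simp: fractional_ideal_def)
  ultimately show ?case
    by blast
next
  let ?K = "quotient_field R"
  interpret K: field ?K
    by (rule field_quotient_field)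
  interpret J: additive_subgroup J ?K
    using J by (simp add: fractional_ideal_def)
  case (sum s t)
  then obtain \<alpha> \<beta> \<gamma> \<delta> where g: "\<alpha> \<in> J" "\<beta> \<in> J" "\<gamma> \<in> J" "\<delta> \<in> J"
    and s: "s = frac_emb R x \<otimes>\<^bsub>?K\<^esub> \<alpha> \<oplus>\<^bsub>?K\<^esub> frac_emb R y \<otimes>\<^bsub>?K\<^esub> \<beta>"
    and t: "t = frac_emb R x \<otimes>\<^bsub>?K\<^esub> \<gamma> \<oplus>\<^bsub>?K\<^esub> frac_emb R y \<otimes>\<^bsub>?K\<^esub> \<delta>"
    by blast
  then have "\<alpha> \<in> carrier ?K" "\<beta> \<in> carrier ?K" "\<gamma> \<in> carrier ?K" "\<delta> \<in> carrier ?K"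
    using J.a_subset by blast+
  then have "s \<oplus>\<^bsub>?K\<^esub> t = frac_emb R x \<otimes>\<^bsub>?K\<^esub> (\<alpha> \<oplus>\<^bsub>?K\<^esub> \<gamma>)
      \<oplus>\<^bsub>?K\<^esub> frac_emb R y \<otimes>\<^bsub>?K\<^esub> (\<beta> \<oplus>\<^bsub>?K\<^esub> \<delta>)"
    unfolding s t using xy frac_emb_closed by (simp add: K.r_distr K.a_ac)
  then show ?case
    using g J.a_closed by blast
qed

text \<open>If \<open>x \<alpha> + w \<beta> = 1\<close> with \<open>\<alpha>\<close> and \<open>\<beta>\<close> in the inverse of the ideal \<open>(x, w)\<close>, take
  \<open>a = x \<alpha>\<close>, \<open>c = w \<alpha>\<close> and \<open>d = x \<beta>\<close>.\<close>

lemma comparison_witness: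
  assumes xw: "x \<in> carrier R" "w \<in> carrier R"
  shows "\<exists>a\<in>carrier R. \<exists>c\<in>carrier R. \<exists>d\<in>carrier R.
    a \<otimes> w = x \<otimes> c \<and> (\<one> \<ominus> a) \<otimes> x = w \<otimes> d \<and> (w = \<zero> \<longrightarrow> a = \<one>)"
proof (cases "w = \<zero>")
  \<comment> \<open>If both elements vanish, the ideal they generate is zero and the two equations
    do not restrict \<open>a\<close>. The choice a = 1 keeps \<open>a\<close> outside every maximal
    ideal.\<close>
  case True
  then show ?thesis
    using xw by (intro bexI[of _ \<one>] bexI[of _ \<zero>]) (auto simp: minus_eq r_neg)
next
  case False
  let ?K = "quotient_field R"
  interpret K: field ?K
    by (rule field_quotient_field)
  have mem: "x \<in> Idl {x, w}" "w \<in> Idl {x, w}"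
    using genideal_self[of "{x, w}"] xw by auto
  with False have "Idl {x, w} \<noteq> {\<zero>}"
    by blast
  then have "invertible_ideal R (Idl {x, w})"
    using pruefer xw unfolding pruefer_domain_def by simp
  then obtain J where J: "fractional_ideal R J"
    and prod: "ideal_prod ?K (frac_emb R ` (Idl {x, w})) J = frac_emb R ` carrier R"
    unfolding invertible_ideal_def by blast
  have "frac_emb R \<one> \<in> ideal_prod ?K (frac_emb R ` (Idl {x, w})) J"
    unfolding prod by blast
  then obtain \<alpha> \<beta> where ab: "\<alpha> \<in> J" "\<beta> \<in> J"
    and one: "frac_emb R \<one> = frac_emb R x \<otimes>\<^bsub>?K\<^esub> \<alpha> \<oplus>\<^bsub>?K\<^esub> frac_emb R w \<otimes>\<^bsub>?K\<^esub> \<beta>"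
    using genideal_pair_mem_prod[OF J xw] by blast
  have "J \<subseteq> carrier ?K"
    using J additive_subgroup.a_subset unfolding fractional_ideal_def by blast
  then have abK: "\<alpha> \<in> carrier ?K" "\<beta> \<in> carrier ?K"
    using ab by auto
  \<comment> \<open>The ideal times its inverse is the image of the domain, so the products of
    \<open>x\<close> and \<open>w\<close> with \<alpha> and \<beta> come from elements of the
    domain.\<close>
  have int: "\<exists>r\<in>carrier R. frac_emb R r = frac_emb R i \<otimes>\<^bsub>?K\<^esub> j" if "i \<in> Idl {x, w}" "j \<in> J" for i j
  proof -
    have "frac_emb R i \<otimes>\<^bsub>?K\<^esub> j \<in> frac_emb R ` carrier R"
      unfolding prod[symmetric] using that by (intro ideal_prod.prod) auto
    then show ?thesis
      by auto
  qed
  obtain a c d b where abcd: "a \<in> carrier R" "c \<in> carrier R" "d \<in> carrier R" "b \<in> carrier R"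
    and a: "frac_emb R a = frac_emb R x \<otimes>\<^bsub>?K\<^esub> \<alpha>" and c: "frac_emb R c = frac_emb R w \<otimes>\<^bsub>?K\<^esub> \<alpha>"
    and d: "frac_emb R d = frac_emb R x \<otimes>\<^bsub>?K\<^esub> \<beta>" and b: "frac_emb R b = frac_emb R w \<otimes>\<^bsub>?K\<^esub> \<beta>"
    using int[OF mem(1) ab(1)] int[OF mem(2) ab(1)] int[OF mem(1) ab(2)] int[OF mem(2) ab(2)]
    by blast
  have emb: "frac_emb R x \<in> carrier ?K" "frac_emb R w \<in> carrier ?K"
    using xw frac_emb_closed by auto
  have "frac_emb R \<one> = frac_emb R (a \<oplus> b)"
    unfolding one using abcd by (simp add: frac_emb_add a b)
  then have "\<one> = a \<oplus> b"
    using abcd frac_emb_eq_iff by auto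
  then have b_eq: "\<one> \<ominus> a = b"
    using abcd by (simp add: minus_eq a_comm[of a b] a_assoc r_neg)
  have "frac_emb R (a \<otimes> w) = frac_emb R (x \<otimes> c)"
    using abcd xw emb abK by (simp add: frac_emb_mult a c K.m_ac)
  then have 1: "a \<otimes> w = x \<otimes> c"
    using frac_emb_eq_iff abcd xw by simp
  have "frac_emb R (b \<otimes> x) = frac_emb R (w \<otimes> d)"
    using abcd xw emb abK by (simp add: frac_emb_mult b d K.m_ac)
  then have "(\<one> \<ominus> a) \<otimes> x = w \<otimes> d"
    using frac_emb_eq_iff abcd xw b_eq by simp
  with 1 show ?thesis
    using abcd False by blast
qed

end

locale pruefer_prime = pruefer R + primeideal M R for R (structure) and M
begin

sublocale domain_prime R M ..

text \<open>Since a and 1 - a add up to 1, they cannot both lie in the proper ideal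
  \<open>M\<close>; the one outside \<open>M\<close> is the multiplier that one of the two
  divisibilities needs.\<close>

lemma loc_dvd_total:
  assumes xw: "x \<in> carrier R" "w \<in> carrier R"
  shows "loc_dvd R M x w \<or> loc_dvd R M w x"
proof -
  obtain a c d where w: "a \<in> carrier R" "c \<in> carrier R" "d \<in> carrier R"
    "a \<otimes> w = x \<otimes> c" "(\<one> \<ominus> a) \<otimes> x = w \<otimes> d"
    using comparison_witness[OF xw] by blast
  show ?thesis
  proof (cases "a \<in> M")
    case False
    then show ?thesis
      unfolding loc_dvd_def using w by blast
  next
    case True
    have "\<one> \<ominus> a \<notin> M"
    proof
      assume "\<one> \<ominus> a \<in> M"
      then have "(\<one> \<ominus> a) \<oplus> a \<in> M"
        using True by (rule additive_subgroup.a_closed[OF is_additive_subgroup])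
      then show False
        using w one_notin by (simp add: minus_eq a_assoc l_neg)
    qed
    then show ?thesis
      unfolding loc_dvd_def using w by (meson Diff_iff minus_closed one_closed)
  qed
qed

text \<open>From x in \<open>M\<close> and s z = x c it follows that z lies in \<open>M\<close>.
  Multiplying (1 - a) x = z z d by s turns one factor z into x c, after which x cancels and the
  other z remains. So s (1 - a), and hence 1 - a, lies in \<open>M\<close>.\<close>

lemma comparison_witness_notin:
  assumes "a \<in> carrier R" "d \<in> carrier R" "x \<in> M" "z \<in> carrier R" "loc_dvd R M x z"
    and eq: "(\<one> \<ominus> a) \<otimes> x = (z \<otimes> z) \<otimes> d" and zero: "z \<otimes> z = \<zero> \<longrightarrow> a = \<one>"
  shows "a \<notin> M"
proof (cases "x = \<zero>")
  \<comment> \<open>Here x cannot be cancelled and the equation is void, so the normalisation a = 1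
    for a vanishing square has to decide.\<close>
  case True
  then have "z = \<zero>"
    using assms loc_dvd_zero_left_iff by simp
  then show ?thesis
    using zero one_notin assms by simp
next
  case False
  have x: "x \<in> carrier R"
    using assms a_subset by blast
  obtain s c where s: "s \<in> carrier R - M" "c \<in> carrier R" "s \<otimes> z = x \<otimes> c"
    using assms unfolding loc_dvd_def by blast
  have "s \<otimes> z \<in> M"
    unfolding s(3) using assms s by (simp add: I_r_closed)
  then have z: "z \<in> M"
    using s assms I_prime by blast
  have b: "\<one> \<ominus> a \<in> carrier R"
    using assms by simp
  have "x \<otimes> (s \<otimes> (\<one> \<ominus> a)) = s \<otimes> ((\<one> \<ominus> a) \<otimes> x)"
    using b x s by (simp add: m_ac)
  also have "\<dots> = (s \<otimes> z) \<otimes> (z \<otimes> d)"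
    unfolding eq using assms(1-4) s(1,2) by (simp add: m_ac)
  also have "\<dots> = x \<otimes> (z \<otimes> (c \<otimes> d))"
    unfolding s(3) using assms s(1,2) x by (simp add: m_ac)
  finally have "s \<otimes> (\<one> \<ominus> a) = z \<otimes> (c \<otimes> d)"
    using m_lcancel[of x "s \<otimes> (\<one> \<ominus> a)" "z \<otimes> (c \<otimes> d)"] False x b s assms by auto
  moreover have "z \<otimes> (c \<otimes> d) \<in> M"
    using z s assms by (simp add: I_r_closed)
  ultimately have b_in: "\<one> \<ominus> a \<in> M"
    using s b I_prime[of s "\<one> \<ominus> a"] by auto
  show "a \<notin> M"
  proof
    assume "a \<in> M"
    with b_in have "(\<one> \<ominus> a) \<oplus> a \<in> M"
      by (intro additive_subgroup.a_closed[OF is_additive_subgroup])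
    then show False
      using assms one_notin by (simp add: minus_eq a_assoc l_neg)
  qed
qed

end

section \<open>Ultrafilters and ultraproducts\<close>

text \<open>Zorn's lemma on the proper ideals above \<open>I\<close>: properness survives unions of
  chains because it means that 1 is missing.\<close>

lemma (in cring) exists_maximalideal:
  assumes "ideal I R" "I \<noteq> carrier R"
  shows "\<exists>M. maximalideal M R \<and> I \<subseteq> M"
proof -
  let ?A = "{J. ideal J R \<and> I \<subseteq> J \<and> J \<noteq> carrier R}"
  have "\<exists>M\<in>?A. \<forall>J\<in>?A. M \<subseteq> J \<longrightarrow> J = M"
  proof (rule subset_Zorn_nonempty)
    show "?A \<noteq> {}"
      using assms by blast
    fix C assume C: "C \<noteq> {}" "subset.chain ?A C"
    then have "subset.chain {I. ideal I R} C"
      unfolding subset.chain_def by blast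
    then have "ideal (\<Union>C) R"
      using chain_Union_is_ideal[of C] C(1) by simp
    moreover have "I \<subseteq> \<Union>C"
      using C unfolding subset.chain_def by blast
    moreover have "\<Union>C \<noteq> carrier R"
    proof
      assume "\<Union>C = carrier R"
      then obtain J where "J \<in> C" "\<one> \<in> J"
        using one_closed by blast
      moreover from this have "ideal J R" "J \<noteq> carrier R"
        using C unfolding subset.chain_def by auto
      ultimately show False
        using ideal.one_imp_carrier[of J R] by simp
    qed
    ultimately show "\<Union>C \<in> ?A"
      by blast
  qed
  then obtain M where "M \<in> ?A" and max: "\<forall>J\<in>?A. M \<subseteq> J \<longrightarrow> J = M"
    by (rule bexE)
  then have M: "ideal M R" "I \<subseteq> M" "M \<noteq> carrier R"
    by auto
  have "maximalideal M R"
  proof (rule maximalidealI)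
    fix J assume "ideal J R" "M \<subseteq> J" "J \<subseteq> carrier R"
    then show "J = M \<or> J = carrier R"
      using max M(2) by (cases "J = carrier R") auto
  qed (use M in auto)
  with M(2) show ?thesis
    by auto
qed

text \<open>The proper filters containing \<open>B\<close> are closed under unions of non-empty
  chains, and a maximal one decides every subset \<open>A\<close> of \<open>Y\<close>: if no member
  misses \<open>A\<close>, then \<open>A\<close> can be adjoined.\<close>

lemma ultrafilter_extends:
  assumes sub: "B \<subseteq> Pow Y" and ne: "B \<noteq> {}" and empty: "{} \<notin> B"
    and inter: "\<And>S T. S \<in> B \<Longrightarrow> T \<in> B \<Longrightarrow> S \<inter> T \<in> B"
  shows "\<exists>\<U>. ultrafilter_on Y \<U> \<and> B \<subseteq> \<U>"
proof -
  define filt where "filt F \<longleftrightarrow> B \<subseteq> F \<and> F \<subseteq> Pow Y \<and> {} \<notin> F \<and>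
    (\<forall>S\<in>F. \<forall>T\<in>F. S \<inter> T \<in> F) \<and> (\<forall>S\<in>F. \<forall>T. S \<subseteq> T \<and> T \<subseteq> Y \<longrightarrow> T \<in> F)" for F
  have "\<exists>M\<in>Collect filt. \<forall>F\<in>Collect filt. M \<subseteq> F \<longrightarrow> F = M"
  proof (rule subset_Zorn_nonempty)
    have "filt {S \<in> Pow Y. \<exists>T\<in>B. T \<subseteq> S}"
      unfolding filt_def
    proof (intro conjI ballI allI impI)
      fix S T assume "S \<in> {S \<in> Pow Y. \<exists>T\<in>B. T \<subseteq> S}" "T \<in> {S \<in> Pow Y. \<exists>T\<in>B. T \<subseteq> S}"
      then obtain S' T' where S': "S \<subseteq> Y" "S' \<in> B" "T' \<in> B" "S' \<subseteq> S" "T' \<subseteq> T"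
        by auto
      then have "S' \<inter> T' \<subseteq> S \<inter> T" "S \<inter> T \<in> Pow Y"
        by auto
      then show "S \<inter> T \<in> {S \<in> Pow Y. \<exists>T\<in>B. T \<subseteq> S}"
        using inter[OF S'(2,3)] by auto
    next
      show "{} \<notin> {S \<in> Pow Y. \<exists>T\<in>B. T \<subseteq> S}"
        using empty by simp
    next
      fix S T assume "S \<in> {S \<in> Pow Y. \<exists>T\<in>B. T \<subseteq> S}" "S \<subseteq> T \<and> T \<subseteq> Y"
      then show "T \<in> {S \<in> Pow Y. \<exists>T\<in>B. T \<subseteq> S}"
        by (auto intro: subset_trans)
    qed (use sub in auto)
    then show "Collect filt \<noteq> {}"
      by blast
    fix C assume C: "C \<noteq> {}" "subset.chain (Collect filt) C"
    have filt: "filt F" if "F \<in> C" for F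
      using C that unfolding subset.chain_def by blast
    have "S \<inter> T \<in> \<Union>C" if S: "S \<in> \<Union>C" and T: "T \<in> \<Union>C" for S T
    proof -
      obtain F G where "F \<in> C" "G \<in> C" "S \<in> F" "T \<in> G"
        using S T by blast
      moreover from this have "F \<subseteq> G \<or> G \<subseteq> F"
        using C unfolding subset_chain_def by blast
      ultimately show ?thesis
        using filt unfolding filt_def by blast
    qed
    moreover obtain F0 where F0: "F0 \<in> C"
      using C(1) by blast
    have "B \<subseteq> \<Union>C"
      using filt[OF F0] F0 unfolding filt_def by blast
    moreover have "F \<subseteq> Pow Y" "{} \<notin> F" if "F \<in> C" for F
      using filt[OF that] unfolding filt_def by simp_all
    then have "\<Union>C \<subseteq> Pow Y" "{} \<notin> \<Union>C"
      by blast+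
    moreover have "T \<in> \<Union>C" if ST: "S \<in> \<Union>C" "S \<subseteq> T" "T \<subseteq> Y" for S T
    proof -
      obtain F where "F \<in> C" "S \<in> F"
        using ST(1) by blast
      then have "T \<in> F"
        using filt[OF \<open>F \<in> C\<close>] ST unfolding filt_def by auto
      with \<open>F \<in> C\<close> show ?thesis
        by blast
    qed
    ultimately show "\<Union>C \<in> Collect filt"
      unfolding mem_Collect_eq filt_def by meson
  qed
  then obtain F where F: "filt F" and max: "\<And>G. filt G \<Longrightarrow> F \<subseteq> G \<Longrightarrow> G = F"
    by blast
  have F_B: "B \<subseteq> F" and F_Pow: "F \<subseteq> Pow Y" and F_empty: "{} \<notin> F"
    and F_inter: "\<And>S T. S \<in> F \<Longrightarrow> T \<in> F \<Longrightarrow> S \<inter> T \<in> F"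
    and F_up: "\<And>S T. S \<in> F \<Longrightarrow> S \<subseteq> T \<Longrightarrow> T \<subseteq> Y \<Longrightarrow> T \<in> F"
    using F unfolding filt_def by auto
  obtain S0 where S0: "S0 \<in> F"
    using ne F_B by blast
  have Y: "Y \<in> F"
    using F_up[OF S0] F_Pow S0 by blast
  have "A \<in> F \<or> Y - A \<in> F" if A: "A \<subseteq> Y" for A
  proof (cases "\<exists>S\<in>F. S \<inter> A = {}")
    case True
    then obtain S where S: "S \<in> F" "S \<inter> A = {}"
      by blast
    then have "S \<subseteq> Y - A"
      using F_Pow by blast
    with S(1) have "Y - A \<in> F"
      by (rule F_up) blast
    then show ?thesis ..
  next
    case False
    \<comment> \<open>The filter generated by \<open>F\<close> and \<open>A\<close>. It is proper
      because every member of \<open>F\<close> meets \<open>A\<close>, so maximality of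
      \<open>F\<close> puts \<open>A\<close> into \<open>F\<close>.\<close>
    define G where "G = {S \<in> Pow Y. \<exists>T\<in>F. T \<inter> A \<subseteq> S}"
    have "F \<subseteq> G"
      using F_Pow unfolding G_def by blast
    moreover have "filt G"
      unfolding filt_def
    proof (intro conjI ballI allI impI)
      show "B \<subseteq> G"
        using \<open>F \<subseteq> G\<close> F_B by (rule subset_trans[rotated])
      show "{} \<notin> G"
        using False unfolding G_def by simp
      fix S T assume "S \<in> G"
      then obtain S' where S': "S \<subseteq> Y" "S' \<in> F" "S' \<inter> A \<subseteq> S"
        unfolding G_def by blast
      {
        assume "T \<in> G"
        then obtain T' where T': "T' \<in> F" "T' \<inter> A \<subseteq> T"
          unfolding G_def by blast
        have "(S' \<inter> T') \<inter> A \<subseteq> S \<inter> T"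
          using S' T' by blast
        then show "S \<inter> T \<in> G"
          using F_inter[OF S'(2) T'(1)] S'(1) unfolding G_def by blast
      }
      assume "S \<subseteq> T \<and> T \<subseteq> Y"
      then show "T \<in> G"
        using S' unfolding G_def by blast
    qed (auto simp: G_def)
    ultimately have "G = F"
      using max by blast
    moreover have "A \<in> G"
      using A Y unfolding G_def by blast
    ultimately show ?thesis
      by simp
  qed
  then have "ultrafilter_on Y F"
    unfolding ultrafilter_on_def using F_Pow F_empty F_inter F_up Y by simp
  then show ?thesis
    using F_B by blast
qed

section \<open>Almost-everywhere statements and ultraproducts\<close>

locale ultrafilter =
  fixes Y :: "'x set" and \<U> :: "'x set set"
  assumes ultrafilter: "ultrafilter_on Y \<U>"
begin

text \<open>To be read as "for almost all p". The rules below pass this quantifier through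
  conjunction, negation and disjunction, in the manner of the theorem of Los.\<close>

definition ev :: "('x \<Rightarrow> bool) \<Rightarrow> bool"
  where "ev P \<longleftrightarrow> {p \<in> Y. P p} \<in> \<U>"

lemma ev_mono:
  assumes "ev P" "\<And>p. p \<in> Y \<Longrightarrow> P p \<Longrightarrow> Q p"
  shows "ev Q"
proof -
  have "{p \<in> Y. P p} \<subseteq> {p \<in> Y. Q p}" "{p \<in> Y. Q p} \<subseteq> Y"
    using assms(2) by auto
  then show ?thesis
    using ultrafilter assms(1) unfolding ultrafilter_on_def ev_def by blast
qed

lemma ev_conj:
  assumes "ev P" "ev Q"
  shows "ev (\<lambda>p. P p \<and> Q p)"
proof -
  have "{p \<in> Y. P p \<and> Q p} = {p \<in> Y. P p} \<inter> {p \<in> Y. Q p}"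
    by auto
  then show ?thesis
    using ultrafilter assms unfolding ultrafilter_on_def ev_def by simp
qed

lemma ev_mono2:
  assumes "ev P" "ev Q" "\<And>p. p \<in> Y \<Longrightarrow> P p \<Longrightarrow> Q p \<Longrightarrow> S p"
  shows "ev S"
  using ev_mono[OF ev_conj[OF assms(1,2)]] assms(3) by blast

lemma ev_all: "(\<And>p. p \<in> Y \<Longrightarrow> P p) \<Longrightarrow> ev P"
  using ultrafilter unfolding ultrafilter_on_def ev_def
  by (metis (mono_tags, lifting) Collect_cong Collect_mem_eq)

lemma ev_False: "\<not> ev (\<lambda>p. False)"
  using ultrafilter unfolding ultrafilter_on_def ev_def by simp

lemma ev_contradiction:
  assumes "ev P" "ev Q" "\<And>p. p \<in> Y \<Longrightarrow> P p \<Longrightarrow> Q p \<Longrightarrow> False"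
  shows False
  using ev_mono2[OF assms(1,2), of "\<lambda>p. False"] assms(3) ev_False by blast

lemma ev_not_iff: "ev (\<lambda>p. \<not> P p) \<longleftrightarrow> \<not> ev P"
proof
  assume "ev (\<lambda>p. \<not> P p)"
  then show "\<not> ev P"
    using ev_contradiction by blast
next
  have "{p \<in> Y. \<not> P p} = Y - {p \<in> Y. P p}" "{p \<in> Y. P p} \<subseteq> Y"
    by auto
  moreover assume "\<not> ev P"
  ultimately show "ev (\<lambda>p. \<not> P p)"
    using ultrafilter unfolding ultrafilter_on_def ev_def by metis
qed

text \<open>This carries totality from the points to the ultraproduct: if one of two comparisons
  holds at each point, then the same one holds almost everywhere.\<close>

lemma ev_disj: "ev (\<lambda>p. P p \<or> Q p) \<Longrightarrow> ev P \<or> ev Q"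
  using ev_contradiction[of "\<lambda>p. P p \<or> Q p"] ev_conj[of "\<lambda>p. \<not> P p" "\<lambda>p. \<not> Q p"]
    ev_not_iff[of P] ev_not_iff[of Q] by blast

lemma ev_cong: "(\<And>p. p \<in> Y \<Longrightarrow> P p \<longleftrightarrow> Q p) \<Longrightarrow> ev P \<longleftrightarrow> ev Q"
  using ev_mono by meson

lemma mem_ultra_class_iff:
  assumes "f \<in> Pi\<^sub>E Y S"
  shows "g \<in> ultra_class Y \<U> S f \<longleftrightarrow> g \<in> Pi\<^sub>E Y S \<and> ev (\<lambda>p. f p = g p)"
  using assms unfolding ultra_class_def ultra_rel_def ev_def by simp

lemma ultra_class_self: "f \<in> Pi\<^sub>E Y S \<Longrightarrow> f \<in> ultra_class Y \<U> S f"
  by (simp add: mem_ultra_class_iff ev_all)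

lemma ultra_class_eq_iff:
  assumes f: "f \<in> Pi\<^sub>E Y S" and g: "g \<in> Pi\<^sub>E Y S"
  shows "ultra_class Y \<U> S f = ultra_class Y \<U> S g \<longleftrightarrow> ev (\<lambda>p. f p = g p)"
proof
  assume "ultra_class Y \<U> S f = ultra_class Y \<U> S g"
  then show "ev (\<lambda>p. f p = g p)"
    using ultra_class_self[OF g] mem_ultra_class_iff[OF f] by blast
next
  assume fg: "ev (\<lambda>p. f p = g p)"
  have "ev (\<lambda>p. f p = h p) \<longleftrightarrow> ev (\<lambda>p. g p = h p)" for h
    using ev_mono2[OF fg, of "\<lambda>p. f p = h p" "\<lambda>p. g p = h p"]
      ev_mono2[OF fg, of "\<lambda>p. g p = h p" "\<lambda>p. f p = h p"] by auto
  then show "ultra_class Y \<U> S f = ultra_class Y \<U> S g"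
    using mem_ultra_class_iff[OF f] mem_ultra_class_iff[OF g] by blast
qed

lemma ultraproduct_carrierE:
  assumes "F \<in> Pi\<^sub>E Y S // ultra_rel Y \<U> S"
  obtains f where "f \<in> Pi\<^sub>E Y S" "F = ultra_class Y \<U> S f"
  using assms unfolding quotient_def ultra_class_def by blast

lemma ultraproduct_ring_mult:
  assumes closed: "\<And>i x y. i \<in> Y \<Longrightarrow> x \<in> carrier (A i) \<Longrightarrow> y \<in> carrier (A i) \<Longrightarrow>
      x \<otimes>\<^bsub>A i\<^esub> y \<in> carrier (A i)"
    and f: "f \<in> (\<Pi>\<^sub>E i\<in>Y. carrier (A i))" and g: "g \<in> (\<Pi>\<^sub>E i\<in>Y. carrier (A i))"
  shows "ultra_class Y \<U> (\<lambda>i. carrier (A i)) f \<otimes>\<^bsub>ultraproduct_ring Y \<U> A\<^esub>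
      ultra_class Y \<U> (\<lambda>i. carrier (A i)) g =
    ultra_class Y \<U> (\<lambda>i. carrier (A i)) (\<lambda>i\<in>Y. f i \<otimes>\<^bsub>A i\<^esub> g i)"
proof -
  let ?cl = "ultra_class Y \<U> (\<lambda>i. carrier (A i))"
  have "?cl (\<lambda>i\<in>Y. f' i \<otimes>\<^bsub>A i\<^esub> g' i) = ?cl (\<lambda>i\<in>Y. f i \<otimes>\<^bsub>A i\<^esub> g i)"
    if "f' \<in> ?cl f" "g' \<in> ?cl g" for f' g'
  proof -
    have f': "f' \<in> (\<Pi>\<^sub>E i\<in>Y. carrier (A i))" "ev (\<lambda>p. f p = f' p)"
      using that mem_ultra_class_iff[OF f] by auto
    have g': "g' \<in> (\<Pi>\<^sub>E i\<in>Y. carrier (A i))" "ev (\<lambda>p. g p = g' p)"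
      using that mem_ultra_class_iff[OF g] by auto
    have "(\<lambda>i\<in>Y. f' i \<otimes>\<^bsub>A i\<^esub> g' i) \<in> (\<Pi>\<^sub>E i\<in>Y. carrier (A i))"
      "(\<lambda>i\<in>Y. f i \<otimes>\<^bsub>A i\<^esub> g i) \<in> (\<Pi>\<^sub>E i\<in>Y. carrier (A i))"
      using f f'(1) g g'(1) closed by (auto simp: PiE_iff)
    then show ?thesis
      using ev_mono2[OF f'(2) g'(2)] by (subst ultra_class_eq_iff) auto
  qed
  then have "(\<Union>f'\<in>?cl f. \<Union>g'\<in>?cl g. ?cl (\<lambda>i\<in>Y. f' i \<otimes>\<^bsub>A i\<^esub> g' i)) = ?cl (\<lambda>i\<in>Y. f i \<otimes>\<^bsub>A i\<^esub> g i)"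
    using ultra_class_self[OF f] ultra_class_self[OF g] by blast
  then show ?thesis
    by (simp add: ultraproduct_ring_def Let_def)
qed

lemma group_le_ultraproduct_iff:
  assumes f: "f \<in> (\<Pi>\<^sub>E i\<in>Y. carrier (A i))" and g: "g \<in> (\<Pi>\<^sub>E i\<in>Y. carrier (A i))"
  shows "group_le (ultraproduct_group Y \<U> A) (ultra_class Y \<U> (\<lambda>i. carrier (A i)) f)
      (ultra_class Y \<U> (\<lambda>i. carrier (A i)) g) \<longleftrightarrow> ev (\<lambda>p. group_le (A p) (f p) (g p))"
proof
  assume "group_le (ultraproduct_group Y \<U> A) (ultra_class Y \<U> (\<lambda>i. carrier (A i)) f)
      (ultra_class Y \<U> (\<lambda>i. carrier (A i)) g)"
  then obtain f' g' where "f' \<in> ultra_class Y \<U> (\<lambda>i. carrier (A i)) f"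
      "g' \<in> ultra_class Y \<U> (\<lambda>i. carrier (A i)) g" and le: "ev (\<lambda>p. group_le (A p) (f' p) (g' p))"
    by (auto simp: ultraproduct_group_def Let_def ev_def)
  then have fg: "ev (\<lambda>p. f p = f' p)" "ev (\<lambda>p. g p = g' p)"
    using mem_ultra_class_iff[OF f] mem_ultra_class_iff[OF g] by auto
  show "ev (\<lambda>p. group_le (A p) (f p) (g p))"
    by (rule ev_mono2[OF ev_conj[OF fg] le]) auto
next
  assume "ev (\<lambda>p. group_le (A p) (f p) (g p))"
  then show "group_le (ultraproduct_group Y \<U> A) (ultra_class Y \<U> (\<lambda>i. carrier (A i)) f)
      (ultra_class Y \<U> (\<lambda>i. carrier (A i)) g)"
    using ultra_class_self[OF f] ultra_class_self[OF g]
    by (auto simp: ultraproduct_group_def Let_def ev_def)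
qed

end

section \<open>The product ring of a family of Pruefer domains\<close>

locale pruefer_family =
  fixes \<Lambda> :: "'i set" and D :: "'i \<Rightarrow> ('a, 'm) ring_scheme"
  assumes pruefer_D: "\<And>l. l \<in> \<Lambda> \<Longrightarrow> pruefer_domain (D l)"
begin

abbreviation "PR \<equiv> product_ring \<Lambda> D"

lemma pruefer_at: "l \<in> \<Lambda> \<Longrightarrow> pruefer (D l)"
  using pruefer_D by (simp add: pruefer_def pruefer_axioms_def pruefer_domain_def)

lemma domain_at: "l \<in> \<Lambda> \<Longrightarrow> domain (D l)"
  using pruefer_D by (simp add: pruefer_domain_def)

lemma cring_at: "l \<in> \<Lambda> \<Longrightarrow> cring (D l)"
  using domain_at by (simp add: domain_def)

lemma ring_at: "l \<in> \<Lambda> \<Longrightarrow> ring (D l)"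
  using cring_at by (simp add: cring_def)

lemma max_unionD:
  assumes "p \<in> max_union \<Lambda> D"
  shows "fst p \<in> \<Lambda>" "maximalideal (snd p) (D (fst p))"
  using assms by (auto simp: max_union_def max_ideals_def)

lemma pruefer_prime_at:
  assumes "p \<in> max_union \<Lambda> D"
  shows "pruefer_prime (D (fst p)) (snd p)"
proof -
  interpret cring "D (fst p)"
    using cring_at max_unionD[OF assms] by blast
  show ?thesis
    using maximalideal_prime[OF max_unionD(2)[OF assms]] pruefer_at[OF max_unionD(1)[OF assms]]
    by (simp add: pruefer_prime_def)
qed

lemma domain_prime_at: "p \<in> max_union \<Lambda> D \<Longrightarrow> domain_prime (D (fst p)) (snd p)"
  using pruefer_prime_at by (simp add: pruefer_prime_def pruefer_def domain_prime_def)

text \<open>The projection from X to \<Lambda> is therefore surjective, so a set of indices can be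
  recovered from its preimage in X.\<close>

lemma max_ideals_nonempty:
  assumes "l \<in> \<Lambda>"
  shows "\<exists>M. M \<in> max_ideals (D l)"
proof -
  interpret domain "D l"
    using domain_at[OF assms] .
  have "{\<zero>\<^bsub>D l\<^esub>} \<noteq> carrier (D l)"
    using one_not_zero one_closed by blast
  then show ?thesis
    using exists_maximalideal[OF zeroideal] unfolding max_ideals_def by blast
qed

lemma carrier_PR: "carrier PR = (\<Pi>\<^sub>E l\<in>\<Lambda>. carrier (D l))"
  by (simp add: product_ring_def)

lemma PR_closed: "x \<in> carrier PR \<Longrightarrow> l \<in> \<Lambda> \<Longrightarrow> x l \<in> carrier (D l)"
  by (auto simp: carrier_PR)

lemma PR_simps:
  "l \<in> \<Lambda> \<Longrightarrow> (x \<otimes>\<^bsub>PR\<^esub> y) l = x l \<otimes>\<^bsub>D l\<^esub> y l"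
  "l \<in> \<Lambda> \<Longrightarrow> (x \<oplus>\<^bsub>PR\<^esub> y) l = x l \<oplus>\<^bsub>D l\<^esub> y l"
  "l \<in> \<Lambda> \<Longrightarrow> \<one>\<^bsub>PR\<^esub> l = \<one>\<^bsub>D l\<^esub>"
  "l \<in> \<Lambda> \<Longrightarrow> \<zero>\<^bsub>PR\<^esub> l = \<zero>\<^bsub>D l\<^esub>"
  by (simp_all add: product_ring_def)

lemma PR_eqI:
  "x \<in> carrier PR \<Longrightarrow> y \<in> carrier PR \<Longrightarrow> (\<And>l. l \<in> \<Lambda> \<Longrightarrow> x l = y l) \<Longrightarrow> x = y"
  unfolding carrier_PR by (rule PiE_ext)

lemma cring_PR: "cring PR"
proof -
  have m: "x \<otimes>\<^bsub>PR\<^esub> y \<in> carrier PR" "x \<oplus>\<^bsub>PR\<^esub> y \<in> carrier PR"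
    if "x \<in> carrier PR" "y \<in> carrier PR" for x y
    using that ring_at by (auto simp: product_ring_def PiE_iff ring.ring_simprules)
  have o: "\<one>\<^bsub>PR\<^esub> \<in> carrier PR" "\<zero>\<^bsub>PR\<^esub> \<in> carrier PR"
    using ring_at by (auto simp: product_ring_def ring.ring_simprules)
  show ?thesis
  proof (rule cringI)
    show "abelian_group PR"
    proof (rule abelian_groupI)
      fix x assume x: "x \<in> carrier PR"
      have n: "(\<lambda>l\<in>\<Lambda>. \<ominus>\<^bsub>D l\<^esub> x l) \<in> carrier PR"
        using PR_closed[OF x] ring_at by (auto simp: carrier_PR ring.ring_simprules)
      have "(\<lambda>l\<in>\<Lambda>. \<ominus>\<^bsub>D l\<^esub> x l) \<oplus>\<^bsub>PR\<^esub> x = \<zero>\<^bsub>PR\<^esub>"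
        using PR_closed[OF x] ring_at
        by (intro PR_eqI m n x o) (simp add: PR_simps ring.ring_simprules)
      with n show "\<exists>y\<in>carrier PR. y \<oplus>\<^bsub>PR\<^esub> x = \<zero>\<^bsub>PR\<^esub>"
        by blast
    qed (auto intro!: PR_eqI m o simp: PR_simps PR_closed ring_at ring.ring_simprules)
    show "comm_monoid PR"
      by (rule comm_monoidI)
        (auto intro!: PR_eqI m o simp: PR_simps PR_closed cring_at cring.cring_simprules
            monoid.r_one ring.is_monoid ring_at)
    fix x y z assume "x \<in> carrier PR" "y \<in> carrier PR" "z \<in> carrier PR"
    then show "(x \<oplus>\<^bsub>PR\<^esub> y) \<otimes>\<^bsub>PR\<^esub> z = x \<otimes>\<^bsub>PR\<^esub> z \<oplus>\<^bsub>PR\<^esub> y \<otimes>\<^bsub>PR\<^esub> z"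
      by (intro PR_eqI m) (auto simp: PR_simps PR_closed cring_at cring.cring_simprules)
  qed
qed

sublocale PR: cring PR
  by (rule cring_PR)

lemma PR_pow:
  assumes "l \<in> \<Lambda>"
  shows "(x [^]\<^bsub>PR\<^esub> n) l = x l [^]\<^bsub>D l\<^esub> (n::nat)"
  using assms by (induction n) (simp_all add: PR_simps nat_pow_def)

end

section \<open>The ultrafilter on X and its image on the index set\<close>

locale pruefer_ultra = pruefer_family \<Lambda> D + ultrafilter "max_union \<Lambda> D" \<U>
  for \<Lambda> :: "'i set" and D :: "'i \<Rightarrow> ('a, 'm) ring_scheme" and \<U>
begin

abbreviation "Y \<equiv> max_union \<Lambda> D"
abbreviation "F \<equiv> index_filter \<Lambda> D \<U>"

text \<open>The index filter is the push-forward of \<open>\<U>\<close> along the projection X to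
  \<Lambda>. The preimage of the image of U contains U, and conversely \<open>S\<close> is the image
  of its own preimage because every component has a maximal ideal.\<close>

lemma index_filter_iff: "S \<in> F \<longleftrightarrow> S \<subseteq> \<Lambda> \<and> ev (\<lambda>p. fst p \<in> S)"
proof
  assume "S \<in> F"
  then obtain U where U: "U \<in> \<U>" "S = {l \<in> \<Lambda>. \<exists>M\<in>max_ideals (D l). (l, M) \<in> U}"
    unfolding index_filter_def by blast
  have "\<U> \<subseteq> Pow Y"
    using ultrafilter unfolding ultrafilter_on_def by (rule conjunct1)
  with U(1) have UX: "U \<subseteq> Y"
    by auto
  then have "{p \<in> Y. p \<in> U} = U"
    by blast
  then have "ev (\<lambda>p. p \<in> U)"
    using U(1) unfolding ev_def by simp
  moreover have "fst p \<in> S" if "p \<in> Y" "p \<in> U" for p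
    using that U(2) by (cases p) (auto simp: max_union_def)
  ultimately have "ev (\<lambda>p. fst p \<in> S)"
    by (rule ev_mono)
  then show "S \<subseteq> \<Lambda> \<and> ev (\<lambda>p. fst p \<in> S)"
    using U(2) by auto
next
  assume S: "S \<subseteq> \<Lambda> \<and> ev (\<lambda>p. fst p \<in> S)"
  have "S = {l \<in> \<Lambda>. \<exists>M\<in>max_ideals (D l). (l, M) \<in> {p \<in> Y. fst p \<in> S}}"
    using S max_ideals_nonempty by (auto simp: max_union_def)
  then show "S \<in> F"
    using S unfolding index_filter_def ev_def by blast
qed

sublocale I: ultrafilter \<Lambda> F
proof
  show "ultrafilter_on \<Lambda> F"
    unfolding ultrafilter_on_def
  proof (intro conjI ballI allI impI)
    show "F \<subseteq> Pow \<Lambda>"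
      using index_filter_iff by blast
    show "\<Lambda> \<in> F"
      unfolding index_filter_iff by (auto intro!: ev_all dest: max_unionD)
    show "{} \<notin> F"
      unfolding index_filter_iff using ev_False by simp
  next
    fix A B assume "A \<in> F" "B \<in> F"
    then show "A \<inter> B \<in> F"
      unfolding index_filter_iff using ev_conj[of "\<lambda>p. fst p \<in> A" "\<lambda>p. fst p \<in> B"] by auto
  next
    fix A B assume "A \<in> F" "A \<subseteq> B \<and> B \<subseteq> \<Lambda>"
    then show "B \<in> F"
      unfolding index_filter_iff using ev_mono[of "\<lambda>p. fst p \<in> A" "\<lambda>p. fst p \<in> B"] by auto
  next
    fix A assume A: "A \<subseteq> \<Lambda>"
    have "ev (\<lambda>p. fst p \<in> A) \<or> ev (\<lambda>p. fst p \<in> \<Lambda> - A)"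
      by (rule ev_disj) (auto intro!: ev_all dest: max_unionD)
    then show "A \<in> F \<or> \<Lambda> - A \<in> F"
      unfolding index_filter_iff using A by blast
  qed
qed

text \<open>Equality of classes over \<Lambda> can thus be read at the points of X, where the
  valuations live.\<close>

lemma ev_index_iff: "I.ev P \<longleftrightarrow> ev (\<lambda>p. P (fst p))"
proof -
  have "I.ev P \<longleftrightarrow> ev (\<lambda>p. fst p \<in> {l \<in> \<Lambda>. P l})"
    unfolding I.ev_def index_filter_iff by auto
  also have "\<dots> \<longleftrightarrow> ev (\<lambda>p. P (fst p))"
    by (rule ev_cong) (auto simp: max_union_def)
  finally show ?thesis .
qed

lemma star_pow:
  assumes "x \<in> carrier PR"
  shows "star \<Lambda> D \<U> x [^]\<^bsub>ultra_R \<Lambda> D \<U>\<^esub> (n::nat) = star \<Lambda> D \<U> (x [^]\<^bsub>PR\<^esub> n)"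
proof (induction n)
  case 0
  show ?case
    by (simp add: nat_pow_def ultra_R_def star_def ultraproduct_ring_def Let_def product_ring_def
        restrict_def)
next
  case (Suc n)
  have eq: "(\<lambda>i\<in>\<Lambda>. (x [^]\<^bsub>PR\<^esub> n) i \<otimes>\<^bsub>D i\<^esub> x i) = x [^]\<^bsub>PR\<^esub> Suc n"
    using assms by (simp add: product_ring_def nat_pow_def)
  have "star \<Lambda> D \<U> x [^]\<^bsub>ultra_R \<Lambda> D \<U>\<^esub> Suc n =
      star \<Lambda> D \<U> (x [^]\<^bsub>PR\<^esub> n) \<otimes>\<^bsub>ultra_R \<Lambda> D \<U>\<^esub> star \<Lambda> D \<U> x"
    using Suc by (simp add: nat_pow_def)
  also have "\<dots> = star \<Lambda> D \<U> (\<lambda>i\<in>\<Lambda>. (x [^]\<^bsub>PR\<^esub> n) i \<otimes>\<^bsub>D i\<^esub> x i)"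
    unfolding star_def ultra_R_def
    using assms PR.nat_pow_closed[OF assms, of n] ring_at
    by (intro I.ultraproduct_ring_mult) (auto simp: carrier_PR ring.ring_simprules)
  finally show ?case
    unfolding eq .
qed

section \<open>Valuation and order expressed by divisibility almost everywhere\<close>

abbreviation "KF \<equiv> \<lambda>l. carrier (quotient_field (D l))"
abbreviation "VG \<equiv> \<lambda>p. max_value_group (D (fst p)) (snd p)"
abbreviation "VGs \<equiv> \<Pi>\<^sub>E p\<in>Y. carrier (VG p)"
abbreviation "vcl \<equiv> ultra_class Y \<U> (\<lambda>p. carrier (VG p))"
abbreviation "fv \<equiv> \<lambda>p. frac_value (D (fst p)) (snd p)"
abbreviation "ldvd \<equiv> \<lambda>p. loc_dvd (D (fst p)) (snd p)"

lemma emb_PiE: "x \<in> carrier PR \<Longrightarrow> (\<lambda>l\<in>\<Lambda>. frac_emb (D l) (x l)) \<in> Pi\<^sub>E \<Lambda> KF"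
  using domain_at PR_closed by (auto simp: domain.frac_emb_closed)

lemma ultra_emb_star:
  assumes x: "x \<in> carrier PR"
  shows "ultra_emb \<Lambda> D \<U> (star \<Lambda> D \<U> x) = ultra_class \<Lambda> F KF (\<lambda>l\<in>\<Lambda>. frac_emb (D l) (x l))"
proof -
  have x': "x \<in> (\<Pi>\<^sub>E l\<in>\<Lambda>. carrier (D l))"
    using x by (simp add: carrier_PR)
  have "ultra_class \<Lambda> F KF (\<lambda>l\<in>\<Lambda>. frac_emb (D l) (f l)) =
      ultra_class \<Lambda> F KF (\<lambda>l\<in>\<Lambda>. frac_emb (D l) (x l))" if "f \<in> star \<Lambda> D \<U> x" for f
  proof -
    have f: "f \<in> carrier PR" "I.ev (\<lambda>l. x l = f l)"
      using that I.mem_ultra_class_iff[OF x'] by (auto simp: star_def carrier_PR)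
    show ?thesis
      using I.ev_mono[OF f(2)] emb_PiE[OF f(1)] emb_PiE[OF x]
      by (subst I.ultra_class_eq_iff) auto
  qed
  moreover have "x \<in> star \<Lambda> D \<U> x"
    unfolding star_def using x' by (rule I.ultra_class_self)
  ultimately show ?thesis
    unfolding ultra_emb_def by blast
qed

lemma max_valuation_emb:
  assumes p: "p \<in> Y" and a: "a \<in> carrier (D (fst p))"
  shows "max_valuation (D (fst p)) (snd p) (frac_emb (D (fst p)) a) =
    (if a = \<zero>\<^bsub>D (fst p)\<^esub> then Infty else Val (fv p a \<one>\<^bsub>D (fst p)\<^esub>))"
proof -
  interpret P: domain_prime "D (fst p)" "snd p"
    using domain_prime_at[OF p] .
  show ?thesis
    unfolding frac_emb_def using a by (intro P.max_valuation_fraction) auto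
qed

text \<open>The ultrafilter leaves two cases: \<open>x\<close> vanishes almost everywhere, or it is
  non-zero almost everywhere. In the second case \<open>x\<close> may still vanish at some points,
  so its value is described as the set of all families that agree with the componentwise values
  almost everywhere.\<close>

lemma ultra_valuation_star:
  assumes x: "x \<in> carrier PR"
  shows "ultra_valuation \<Lambda> D \<U> (ultra_emb \<Lambda> D \<U> (star \<Lambda> D \<U> x)) =
    (if ev (\<lambda>p. x (fst p) = \<zero>\<^bsub>D (fst p)\<^esub>) then Infty
     else Val {\<gamma> \<in> VGs. ev (\<lambda>p. x (fst p) \<noteq> \<zero>\<^bsub>D (fst p)\<^esub> \<and>
       \<gamma> p = fv p (x (fst p)) \<one>\<^bsub>D (fst p)\<^esub>)})"
proof -
  let ?k = "\<lambda>l\<in>\<Lambda>. frac_emb (D l) (x l)"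
  let ?C = "ultra_class \<Lambda> F KF ?k"
  have k: "?k \<in> Pi\<^sub>E \<Lambda> KF"
    using emb_PiE[OF x] .
  have "\<zero>\<^bsub>quotient_field (D l)\<^esub> \<in> KF l" if "l \<in> \<Lambda>" for l
    using domain.cring_quotient_field[OF domain_at[OF that]] by (rule cring.cring_simprules)
  then have z: "(\<lambda>l\<in>\<Lambda>. \<zero>\<^bsub>quotient_field (D l)\<^esub>) \<in> Pi\<^sub>E \<Lambda> KF"
    by simp
  have "\<zero>\<^bsub>ultra_K \<Lambda> D \<U>\<^esub> = ultra_class \<Lambda> F KF (\<lambda>l\<in>\<Lambda>. \<zero>\<^bsub>quotient_field (D l)\<^esub>)"
    by (simp add: ultra_K_def ultraproduct_ring_def Let_def)
  then have "?C = \<zero>\<^bsub>ultra_K \<Lambda> D \<U>\<^esub> \<longleftrightarrow>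
      I.ev (\<lambda>l. ?k l = (\<lambda>l\<in>\<Lambda>. \<zero>\<^bsub>quotient_field (D l)\<^esub>) l)"
    using I.ultra_class_eq_iff[OF k z] by simp
  also have "\<dots> \<longleftrightarrow> I.ev (\<lambda>l. x l = \<zero>\<^bsub>D l\<^esub>)"
    using domain_at PR_closed[OF x] by (intro I.ev_cong) (simp add: domain.frac_emb_eq_zero_iff)
  finally have zero: "?C = \<zero>\<^bsub>ultra_K \<Lambda> D \<U>\<^esub> \<longleftrightarrow> ev (\<lambda>p. x (fst p) = \<zero>\<^bsub>D (fst p)\<^esub>)"
    by (simp add: ev_index_iff)
  \<comment> \<open>A representative of the class agrees with the embedded \<open>x\<close> at
    almost all indices, hence at almost all points of X, so the union over representatives adds
    nothing to the contribution of \<open>x\<close>.\<close>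
  have val: "ev (\<lambda>p. max_valuation (D (fst p)) (snd p) (k' (fst p)) = Val (\<gamma> p)) \<longleftrightarrow>
      ev (\<lambda>p. x (fst p) \<noteq> \<zero>\<^bsub>D (fst p)\<^esub> \<and> \<gamma> p = fv p (x (fst p)) \<one>\<^bsub>D (fst p)\<^esub>)" (is "?L \<longleftrightarrow> ?R")
    if "k' \<in> ?C" for k' \<gamma>
  proof -
    have "I.ev (\<lambda>l. ?k l = k' l)"
      using that I.mem_ultra_class_iff[OF k] by blast
    then have kk: "ev (\<lambda>p. ?k (fst p) = k' (fst p))"
      unfolding ev_index_iff .
    have mv: "max_valuation (D (fst p)) (snd p) (k' (fst p)) = Val (\<gamma> p) \<longleftrightarrow>
        x (fst p) \<noteq> \<zero>\<^bsub>D (fst p)\<^esub> \<and> \<gamma> p = fv p (x (fst p)) \<one>\<^bsub>D (fst p)\<^esub>"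
      if p: "p \<in> Y" "?k (fst p) = k' (fst p)" for p
      using max_valuation_emb[OF p(1), of "x (fst p)"] p PR_closed[OF x] max_unionD[OF p(1)]
      by (auto split: if_splits)
    show ?thesis
      using ev_mono2[OF kk, of _ "\<lambda>p. x (fst p) \<noteq> \<zero>\<^bsub>D (fst p)\<^esub> \<and> \<gamma> p = fv p (x (fst p)) \<one>\<^bsub>D (fst p)\<^esub>"]
        ev_mono2[OF kk, of _ "\<lambda>p. max_valuation (D (fst p)) (snd p) (k' (fst p)) = Val (\<gamma> p)"] mv
      by blast
  qed
  have "(\<Union>k'\<in>?C. {\<gamma> \<in> VGs. ev (\<lambda>p. max_valuation (D (fst p)) (snd p) (k' (fst p)) = Val (\<gamma> p))}) =
      {\<gamma> \<in> VGs. ev (\<lambda>p. x (fst p) \<noteq> \<zero>\<^bsub>D (fst p)\<^esub> \<and> \<gamma> p = fv p (x (fst p)) \<one>\<^bsub>D (fst p)\<^esub>)}"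
    using val I.ultra_class_self[OF k] by blast
  then show ?thesis
    unfolding ultra_emb_star[OF x] ultra_valuation_def zero ev_def[symmetric] by simp
qed

lemma Infty_le_valuation_iff:
  assumes x: "x \<in> carrier PR"
  shows "ext_le (ultra_value_group \<Lambda> D \<U>) Infty
      (ultra_valuation \<Lambda> D \<U> (ultra_emb \<Lambda> D \<U> (star \<Lambda> D \<U> x))) \<longleftrightarrow>
    ev (\<lambda>p. x (fst p) = \<zero>\<^bsub>D (fst p)\<^esub>)"
  unfolding ultra_valuation_star[OF x] by (simp add: ext_le_def)

text \<open>The inequality v(a/b) \<le> v(x) with its denominators cleared. If \<open>x\<close>
  vanishes almost everywhere, both sides are true, because everything divides zero.\<close>

lemma Val_le_valuation_iff:
  assumes x: "x \<in> carrier PR" and \<gamma>: "\<gamma> \<in> VGs"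
    and ab: "\<And>p. p \<in> Y \<Longrightarrow> a p \<in> carrier (D (fst p)) - {\<zero>\<^bsub>D (fst p)\<^esub>}"
      "\<And>p. p \<in> Y \<Longrightarrow> b p \<in> carrier (D (fst p)) - {\<zero>\<^bsub>D (fst p)\<^esub>}"
      "\<And>p. p \<in> Y \<Longrightarrow> \<gamma> p = fv p (a p) (b p)"
  shows "ext_le (ultra_value_group \<Lambda> D \<U>) (Val (vcl \<gamma>))
      (ultra_valuation \<Lambda> D \<U> (ultra_emb \<Lambda> D \<U> (star \<Lambda> D \<U> x))) \<longleftrightarrow>
    ev (\<lambda>p. ldvd p (a p) (x (fst p) \<otimes>\<^bsub>D (fst p)\<^esub> b p))"
proof (cases "ev (\<lambda>p. x (fst p) = \<zero>\<^bsub>D (fst p)\<^esub>)")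
  case True
  have "ev (\<lambda>p. ldvd p (a p) (x (fst p) \<otimes>\<^bsub>D (fst p)\<^esub> b p))"
  proof (rule ev_mono[OF True])
    fix p assume p: "p \<in> Y" "x (fst p) = \<zero>\<^bsub>D (fst p)\<^esub>"
    interpret P: domain_prime "D (fst p)" "snd p"
      using domain_prime_at[OF p(1)] .
    show "ldvd p (a p) (x (fst p) \<otimes>\<^bsub>D (fst p)\<^esub> b p)"
      using p ab P.loc_dvd_zero by simp
  qed
  then show ?thesis
    unfolding ultra_valuation_star[OF x] using True by (simp add: ext_le_def)
next
  case False
  then have nz: "ev (\<lambda>p. x (fst p) \<noteq> \<zero>\<^bsub>D (fst p)\<^esub>)"
    by (simp add: ev_not_iff)
  \<comment> \<open>A genuine family of group elements representing v(x). Where \<open>x\<close>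
    vanishes it takes the neutral element, the value of 1/1, as a default; these points do not form
    a member of the ultrafilter.\<close>
  define \<delta> where "\<delta> = (\<lambda>p\<in>Y. if x (fst p) \<noteq> \<zero>\<^bsub>D (fst p)\<^esub>
    then fv p (x (fst p)) \<one>\<^bsub>D (fst p)\<^esub> else fv p \<one>\<^bsub>D (fst p)\<^esub> \<one>\<^bsub>D (fst p)\<^esub>)"
  have \<delta>: "\<delta> \<in> VGs"
    unfolding \<delta>_def
  proof (rule restrict_PiE_iff[THEN iffD2], rule ballI)
    fix p assume p: "p \<in> Y"
    interpret P: domain_prime "D (fst p)" "snd p"
      using domain_prime_at[OF p] .
    show "(if x (fst p) \<noteq> \<zero>\<^bsub>D (fst p)\<^esub> then fv p (x (fst p)) \<one>\<^bsub>D (fst p)\<^esub>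
        else fv p \<one>\<^bsub>D (fst p)\<^esub> \<one>\<^bsub>D (fst p)\<^esub>) \<in> carrier (VG p)"
      using PR_closed[OF x] max_unionD(1)[OF p] P.frac_value_closed by auto
  qed
  have "{\<gamma> \<in> VGs. ev (\<lambda>p. x (fst p) \<noteq> \<zero>\<^bsub>D (fst p)\<^esub> \<and> \<gamma> p = fv p (x (fst p)) \<one>\<^bsub>D (fst p)\<^esub>)} = vcl \<delta>"
  proof -
    have "ev (\<lambda>p. x (fst p) \<noteq> \<zero>\<^bsub>D (fst p)\<^esub> \<and> \<epsilon> p = fv p (x (fst p)) \<one>\<^bsub>D (fst p)\<^esub>) \<longleftrightarrow>
        ev (\<lambda>p. \<delta> p = \<epsilon> p)" for \<epsilon>
      using ev_mono2[OF nz, of _ "\<lambda>p. \<delta> p = \<epsilon> p"]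
        ev_mono2[OF nz, of _ "\<lambda>p. x (fst p) \<noteq> \<zero>\<^bsub>D (fst p)\<^esub> \<and> \<epsilon> p = fv p (x (fst p)) \<one>\<^bsub>D (fst p)\<^esub>"]
      unfolding \<delta>_def by (smt (verit) restrict_apply')
    then show ?thesis
      using mem_ultra_class_iff[OF \<delta>] by auto
  qed
  then have "ext_le (ultra_value_group \<Lambda> D \<U>) (Val (vcl \<gamma>))
      (ultra_valuation \<Lambda> D \<U> (ultra_emb \<Lambda> D \<U> (star \<Lambda> D \<U> x))) \<longleftrightarrow>
      group_le (ultraproduct_group Y \<U> VG) (vcl \<gamma>) (vcl \<delta>)"
    unfolding ultra_valuation_star[OF x] using False
    by (simp add: ext_le_def ultra_value_group_def)
  also have "\<dots> \<longleftrightarrow> ev (\<lambda>p. group_le (VG p) (\<gamma> p) (\<delta> p))"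
    using group_le_ultraproduct_iff[OF \<gamma> \<delta>] .
  also have "\<dots> \<longleftrightarrow> ev (\<lambda>p. ldvd p (a p) (x (fst p) \<otimes>\<^bsub>D (fst p)\<^esub> b p))"
  proof -
    have *: "group_le (VG p) (\<gamma> p) (\<delta> p) \<longleftrightarrow> ldvd p (a p) (x (fst p) \<otimes>\<^bsub>D (fst p)\<^esub> b p)"
      if p: "p \<in> Y" and nzp: "x (fst p) \<noteq> \<zero>\<^bsub>D (fst p)\<^esub>" for p
    proof -
      interpret P: domain_prime "D (fst p)" "snd p"
        using domain_prime_at[OF p] .
      show ?thesis
        using P.group_le_frac_value_iff[OF ab(1)[OF p] ab(2)[OF p], of "x (fst p)" "\<one>\<^bsub>D (fst p)\<^esub>"]
          nzp p PR_closed[OF x max_unionD(1)[OF p]] ab(1)[OF p] unfolding ab(3)[OF p] \<delta>_def by simp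
    qed
    show ?thesis
      using ev_mono2[OF nz, of _ "\<lambda>p. group_le (VG p) (\<gamma> p) (\<delta> p)"] *
        ev_mono2[OF nz, of _ "\<lambda>p. ldvd p (a p) (x (fst p) \<otimes>\<^bsub>D (fst p)\<^esub> b p)"] by blast
  qed
  finally show ?thesis .
qed

lemma one_VGs: "(\<lambda>p\<in>Y. fv p \<one>\<^bsub>D (fst p)\<^esub> \<one>\<^bsub>D (fst p)\<^esub>) \<in> VGs"
proof (rule restrict_PiE_iff[THEN iffD2], rule ballI)
  fix p assume p: "p \<in> Y"
  interpret P: domain_prime "D (fst p)" "snd p"
    using domain_prime_at[OF p] .
  show "fv p \<one>\<^bsub>D (fst p)\<^esub> \<one>\<^bsub>D (fst p)\<^esub> \<in> carrier (VG p)"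
    using P.frac_value_closed by simp
qed

lemma one_ultra_value_group:
  "\<one>\<^bsub>ultra_value_group \<Lambda> D \<U>\<^esub> = vcl (\<lambda>p\<in>Y. fv p \<one>\<^bsub>D (fst p)\<^esub> \<one>\<^bsub>D (fst p)\<^esub>)"
proof -
  have "(\<lambda>p\<in>Y. \<one>\<^bsub>VG p\<^esub>) = (\<lambda>p\<in>Y. fv p \<one>\<^bsub>D (fst p)\<^esub> \<one>\<^bsub>D (fst p)\<^esub>)"
    using domain_prime_at domain_prime.one_max_value_group by (intro restrict_ext) blast
  then show ?thesis
    by (simp add: ultra_value_group_def ultraproduct_group_def Let_def)
qed

text \<open>Positivity means at least, but not equal to, the neutral element. By totality at each
  point, the failure of v(a) \<le> v(b) already yields the opposite inequality, so the two
  conditions merge into one.\<close>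

lemma Val_mem_ext_positive_iff:
  assumes \<gamma>: "\<gamma> \<in> VGs"
    and ab: "\<And>p. p \<in> Y \<Longrightarrow> a p \<in> carrier (D (fst p)) - {\<zero>\<^bsub>D (fst p)\<^esub>}"
      "\<And>p. p \<in> Y \<Longrightarrow> b p \<in> carrier (D (fst p)) - {\<zero>\<^bsub>D (fst p)\<^esub>}"
      "\<And>p. p \<in> Y \<Longrightarrow> \<gamma> p = fv p (a p) (b p)"
  shows "Val (vcl \<gamma>) \<in> ext_positive (ultra_value_group \<Lambda> D \<U>) \<longleftrightarrow> ev (\<lambda>p. \<not> ldvd p (a p) (b p))"
proof -
  let ?one = "\<lambda>p\<in>Y. fv p \<one>\<^bsub>D (fst p)\<^esub> \<one>\<^bsub>D (fst p)\<^esub>"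
  have "vcl \<gamma> \<in> carrier (ultra_value_group \<Lambda> D \<U>)"
    using \<gamma> by (auto simp: ultra_value_group_def ultraproduct_group_def Let_def ultra_class_def quotient_def)
  then have "Val (vcl \<gamma>) \<in> ext_positive (ultra_value_group \<Lambda> D \<U>) \<longleftrightarrow>
      group_le (ultraproduct_group Y \<U> VG) (vcl ?one) (vcl \<gamma>) \<and> vcl \<gamma> \<noteq> vcl ?one"
    by (auto simp: ext_positive_def ext_le_def one_ultra_value_group)
      (simp_all add: ultra_value_group_def)
  also have "\<dots> \<longleftrightarrow> ev (\<lambda>p. group_le (VG p) (?one p) (\<gamma> p)) \<and> ev (\<lambda>p. \<gamma> p \<noteq> ?one p)"
    unfolding group_le_ultraproduct_iff[OF one_VGs \<gamma>] ultra_class_eq_iff[OF \<gamma> one_VGs] ev_not_iff ..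
  also have "ev (\<lambda>p. group_le (VG p) (?one p) (\<gamma> p)) \<longleftrightarrow> ev (\<lambda>p. ldvd p (b p) (a p))"
  proof (rule ev_cong)
    fix p assume p: "p \<in> Y"
    interpret P: domain_prime "D (fst p)" "snd p"
      using domain_prime_at[OF p] .
    show "group_le (VG p) (?one p) (\<gamma> p) \<longleftrightarrow> ldvd p (b p) (a p)"
      using P.group_le_frac_value_iff[OF _ _ ab(1,2)[OF p], of "\<one>\<^bsub>D (fst p)\<^esub>" "\<one>\<^bsub>D (fst p)\<^esub>"]
        p ab by simp
  qed
  also have "ev (\<lambda>p. \<gamma> p \<noteq> ?one p) \<longleftrightarrow> ev (\<lambda>p. \<not> (ldvd p (a p) (b p) \<and> ldvd p (b p) (a p)))"
  proof (rule ev_cong)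
    fix p assume p: "p \<in> Y"
    interpret P: domain_prime "D (fst p)" "snd p"
      using domain_prime_at[OF p] .
    show "\<gamma> p \<noteq> ?one p \<longleftrightarrow> \<not> (ldvd p (a p) (b p) \<and> ldvd p (b p) (a p))"
      using P.frac_value_eq_iff[OF ab(1,2)[OF p], of "\<one>\<^bsub>D (fst p)\<^esub>" "\<one>\<^bsub>D (fst p)\<^esub>"]
        p ab by simp
  qed
  also have "ev (\<lambda>p. ldvd p (b p) (a p)) \<and>
      ev (\<lambda>p. \<not> (ldvd p (a p) (b p) \<and> ldvd p (b p) (a p))) \<longleftrightarrow> ev (\<lambda>p. \<not> ldvd p (a p) (b p))"
    (is "?P \<longleftrightarrow> ?Q")
  proof
    assume P: "?P"
    show "?Q"
      by (rule ev_mono2[OF P[THEN conjunct1] P[THEN conjunct2]]) auto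
  next
    assume Q: "?Q"
    have "ldvd p (b p) (a p)" if "p \<in> Y" "\<not> ldvd p (a p) (b p)" for p
      using pruefer_prime.loc_dvd_total[OF pruefer_prime_at[OF that(1)], of "a p" "b p"]
        ab(1,2)[OF that(1)] that(2) by simp
    then have "ev (\<lambda>p. ldvd p (b p) (a p))"
      by (rule ev_mono[OF Q])
    moreover have "ev (\<lambda>p. \<not> (ldvd p (a p) (b p) \<and> ldvd p (b p) (a p)))"
      by (rule ev_mono[OF Q]) simp
    ultimately show "?P" ..
  qed
  finally show ?thesis .
qed

lemma ultra_ideal_Infty:
  "ultra_ideal \<Lambda> D \<U> Infty =
    {x \<in> carrier PR. \<exists>n::nat. ev (\<lambda>p. x (fst p) [^]\<^bsub>D (fst p)\<^esub> n = \<zero>\<^bsub>D (fst p)\<^esub>)}"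
proof -
  have "ev (\<lambda>p. (x [^]\<^bsub>PR\<^esub> n) (fst p) = \<zero>\<^bsub>D (fst p)\<^esub>) \<longleftrightarrow>
      ev (\<lambda>p. x (fst p) [^]\<^bsub>D (fst p)\<^esub> n = \<zero>\<^bsub>D (fst p)\<^esub>)" for x and n :: nat
    by (rule ev_cong) (simp add: PR_pow max_unionD)
  then show ?thesis
    unfolding ultra_ideal_def by (auto simp: star_pow Infty_le_valuation_iff)
qed

lemma ultra_ideal_Val:
  assumes \<gamma>: "\<gamma> \<in> VGs"
    and ab: "\<And>p. p \<in> Y \<Longrightarrow> a p \<in> carrier (D (fst p)) - {\<zero>\<^bsub>D (fst p)\<^esub>}"
      "\<And>p. p \<in> Y \<Longrightarrow> b p \<in> carrier (D (fst p)) - {\<zero>\<^bsub>D (fst p)\<^esub>}"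
      "\<And>p. p \<in> Y \<Longrightarrow> \<gamma> p = fv p (a p) (b p)"
  shows "ultra_ideal \<Lambda> D \<U> (Val (vcl \<gamma>)) =
    {x \<in> carrier PR. \<exists>n::nat. ev (\<lambda>p. ldvd p (a p) (x (fst p) [^]\<^bsub>D (fst p)\<^esub> n \<otimes>\<^bsub>D (fst p)\<^esub> b p))}"
proof -
  have "ev (\<lambda>p. ldvd p (a p) ((x [^]\<^bsub>PR\<^esub> n) (fst p) \<otimes>\<^bsub>D (fst p)\<^esub> b p)) \<longleftrightarrow>
      ev (\<lambda>p. ldvd p (a p) (x (fst p) [^]\<^bsub>D (fst p)\<^esub> n \<otimes>\<^bsub>D (fst p)\<^esub> b p))" for x and n :: nat
    by (rule ev_cong) (simp add: PR_pow max_unionD)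
  then show ?thesis
    unfolding ultra_ideal_def using Val_le_valuation_iff[OF _ \<gamma> ab] by (auto simp: star_pow)
qed

end

section \<open>Prime ideals of the product\<close>

lemma (in primeideal) pow_memD:
  assumes "x \<in> carrier R" "x [^] (n::nat) \<in> I"
  shows "x \<in> I"
  using assms(2)
proof (induction n)
  case 0
  then show ?case
    using I_notcarr one_imp_carrier by simp
next
  case (Suc n)
  then show ?case
    using I_prime[of "x [^] n" x] assms(1) by auto
qed

section \<open>Positive extended values as quotients\<close>

context pruefer_ultra
begin

text \<open>The last condition is v(a/b) > 0, which keeps 1 out of the ideal. Only \<open>b\<close>
  has to be non-zero, so that the value \<infinity> is covered.\<close>

definition admissible :: "('i \<times> 'a set \<Rightarrow> 'a) \<Rightarrow> ('i \<times> 'a set \<Rightarrow> 'a) \<Rightarrow> bool"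
  where "admissible a b \<longleftrightarrow>
    (\<forall>p\<in>Y. a p \<in> carrier (D (fst p)) \<and> b p \<in> carrier (D (fst p)) - {\<zero>\<^bsub>D (fst p)\<^esub>}) \<and>
    ev (\<lambda>p. \<not> ldvd p (a p) (b p))"

text \<open>The quotient \<open>a / b\<close> plays the role of an element of the extended value group, \<open>a = 0\<close>
  giving \<open>\<infinity>\<close>.\<close>

definition ideal_of_quotient :: "('i \<times> 'a set \<Rightarrow> 'a) \<Rightarrow> ('i \<times> 'a set \<Rightarrow> 'a) \<Rightarrow> ('i \<Rightarrow> 'a) set"
  where "ideal_of_quotient a b = {x \<in> carrier PR.
    \<exists>n::nat. ev (\<lambda>p. ldvd p (a p) (x (fst p) [^]\<^bsub>D (fst p)\<^esub> n \<otimes>\<^bsub>D (fst p)\<^esub> b p))}"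

lemma PR_closed_at: "x \<in> carrier PR \<Longrightarrow> p \<in> Y \<Longrightarrow> x (fst p) \<in> carrier (D (fst p))"
  using PR_closed max_unionD by blast

lemma admissibleD:
  assumes "admissible a b"
  shows "\<And>p. p \<in> Y \<Longrightarrow> a p \<in> carrier (D (fst p))"
    and "\<And>p. p \<in> Y \<Longrightarrow> b p \<in> carrier (D (fst p)) - {\<zero>\<^bsub>D (fst p)\<^esub>}"
    and "\<And>p. p \<in> Y \<Longrightarrow> b p \<in> carrier (D (fst p))"
    and "ev (\<lambda>p. \<not> ldvd p (a p) (b p))"
  using assms unfolding admissible_def by simp_all

text \<open>This lets \<infinity> and the group elements be treated together from here on. For
  \<infinity> the quotient is 0/1: zero divides only zero, so the condition becomes the vanishing of
  a power of \<open>x\<close> almost everywhere. A group element has a representing family, whose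
  entries are fractions chosen point by point.\<close>

lemma ultra_ideal_representation:
  assumes "g \<in> ext_positive (ultra_value_group \<Lambda> D \<U>)"
  shows "\<exists>a b. admissible a b \<and> ultra_ideal \<Lambda> D \<U> g = ideal_of_quotient a b"
proof (cases g)
  case Infty
  let ?a = "\<lambda>p. \<zero>\<^bsub>D (fst p)\<^esub>" and ?b = "\<lambda>p. \<one>\<^bsub>D (fst p)\<^esub>"
  have *: "ldvd p (?a p) (y \<otimes>\<^bsub>D (fst p)\<^esub> ?b p) \<longleftrightarrow> y = \<zero>\<^bsub>D (fst p)\<^esub>"
    if "p \<in> Y" "y \<in> carrier (D (fst p))" for p y
  proof -
    interpret P: domain_prime "D (fst p)" "snd p"
      using domain_prime_at[OF that(1)] .
    show ?thesis
      using that P.loc_dvd_zero_left_iff by simp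
  qed
  have adm: "admissible ?a ?b"
    unfolding admissible_def
  proof (intro conjI ballI ev_all)
    fix p assume p: "p \<in> Y"
    interpret P: domain_prime "D (fst p)" "snd p"
      using domain_prime_at[OF p] .
    show "?a p \<in> carrier (D (fst p))" "?b p \<in> carrier (D (fst p)) - {\<zero>\<^bsub>D (fst p)\<^esub>}"
      by simp_all
    show "\<not> ldvd p (?a p) (?b p)"
      using P.loc_dvd_zero_left_iff by simp
  qed
  have "ev (\<lambda>p. ldvd p (?a p) (x (fst p) [^]\<^bsub>D (fst p)\<^esub> n \<otimes>\<^bsub>D (fst p)\<^esub> ?b p)) \<longleftrightarrow>
      ev (\<lambda>p. x (fst p) [^]\<^bsub>D (fst p)\<^esub> n = \<zero>\<^bsub>D (fst p)\<^esub>)"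
    if "x \<in> carrier PR" for x and n :: nat
  proof (rule ev_cong)
    fix p assume p: "p \<in> Y"
    interpret P: domain_prime "D (fst p)" "snd p"
      using domain_prime_at[OF p] .
    show "ldvd p (?a p) (x (fst p) [^]\<^bsub>D (fst p)\<^esub> n \<otimes>\<^bsub>D (fst p)\<^esub> ?b p) \<longleftrightarrow>
        x (fst p) [^]\<^bsub>D (fst p)\<^esub> n = \<zero>\<^bsub>D (fst p)\<^esub>"
      using *[OF p] PR_closed_at[OF that p] by simp
  qed
  then have "ultra_ideal \<Lambda> D \<U> g = ideal_of_quotient ?a ?b"
    unfolding Infty ultra_ideal_Infty ideal_of_quotient_def by auto
  with adm show ?thesis
    by auto
next
  case (Val G)
  then have "G \<in> carrier (ultra_value_group \<Lambda> D \<U>)"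
    using assms by (auto simp: ext_positive_def)
  then obtain \<gamma> where \<gamma>: "\<gamma> \<in> VGs" "G = vcl \<gamma>"
    unfolding ultra_value_group_def ultraproduct_group_def Let_def
    by (auto elim: ultraproduct_carrierE)
  have "\<exists>a b. a \<in> carrier (D (fst p)) - {\<zero>\<^bsub>D (fst p)\<^esub>} \<and>
      b \<in> carrier (D (fst p)) - {\<zero>\<^bsub>D (fst p)\<^esub>} \<and> \<gamma> p = fv p a b" if p: "p \<in> Y" for p
  proof -
    have "\<gamma> p \<in> carrier (VG p)"
      using \<gamma>(1) p by (rule PiE_mem)
    then show ?thesis
      unfolding domain_prime.carrier_max_value_group[OF domain_prime_at[OF p]] by auto
  qed
  then obtain a b where ab: "\<And>p. p \<in> Y \<Longrightarrow> a p \<in> carrier (D (fst p)) - {\<zero>\<^bsub>D (fst p)\<^esub>}"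
      "\<And>p. p \<in> Y \<Longrightarrow> b p \<in> carrier (D (fst p)) - {\<zero>\<^bsub>D (fst p)\<^esub>}"
      "\<And>p. p \<in> Y \<Longrightarrow> \<gamma> p = fv p (a p) (b p)"
    by metis
  have "ev (\<lambda>p. \<not> ldvd p (a p) (b p))"
    using assms[unfolded Val \<gamma>(2)] Val_mem_ext_positive_iff[OF \<gamma>(1) ab] by simp
  then have "admissible a b"
    using ab unfolding admissible_def by simp
  moreover have "ultra_ideal \<Lambda> D \<U> g = ideal_of_quotient a b"
    unfolding Val \<gamma>(2) ideal_of_quotient_def by (rule ultra_ideal_Val[OF \<gamma>(1) ab])
  ultimately show ?thesis
    by auto
qed

text \<open>The witness is g = v(x), which is positive because \<open>x\<close> lies in almost all
  of the maximal ideals. If \<open>x\<close> vanishes almost everywhere, then g =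
  \<infinity>.\<close>

lemma ultra_ideal_of_element:
  assumes x: "x \<in> carrier PR" and xM: "ev (\<lambda>p. x (fst p) \<in> snd p)"
  shows "\<exists>g\<in>ext_positive (ultra_value_group \<Lambda> D \<U>). ultra_ideal \<Lambda> D \<U> g =
    {y \<in> carrier PR. \<exists>n::nat. ev (\<lambda>p. ldvd p (x (fst p)) (y (fst p) [^]\<^bsub>D (fst p)\<^esub> n))}"
proof (cases "ev (\<lambda>p. x (fst p) = \<zero>\<^bsub>D (fst p)\<^esub>)")
  case True
  have "ev (\<lambda>p. ldvd p (x (fst p)) (y (fst p) [^]\<^bsub>D (fst p)\<^esub> n)) \<longleftrightarrow>
      ev (\<lambda>p. y (fst p) [^]\<^bsub>D (fst p)\<^esub> n = \<zero>\<^bsub>D (fst p)\<^esub>)"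
    if "y \<in> carrier PR" for y and n :: nat
  proof -
    have eq: "ldvd p (x (fst p)) (y (fst p) [^]\<^bsub>D (fst p)\<^esub> n) \<longleftrightarrow>
        y (fst p) [^]\<^bsub>D (fst p)\<^esub> n = \<zero>\<^bsub>D (fst p)\<^esub>" if "p \<in> Y" "x (fst p) = \<zero>\<^bsub>D (fst p)\<^esub>" for p
    proof -
      interpret P: domain_prime "D (fst p)" "snd p"
        using domain_prime_at[OF that(1)] .
      show ?thesis
        using that PR_closed_at[OF \<open>y \<in> carrier PR\<close>] P.loc_dvd_zero_left_iff by simp
    qed
    show ?thesis
    proof
      assume "ev (\<lambda>p. ldvd p (x (fst p)) (y (fst p) [^]\<^bsub>D (fst p)\<^esub> n))"
      then show "ev (\<lambda>p. y (fst p) [^]\<^bsub>D (fst p)\<^esub> n = \<zero>\<^bsub>D (fst p)\<^esub>)"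
        by (rule ev_mono2[OF True]) (rule eq[THEN iffD1])
    next
      assume "ev (\<lambda>p. y (fst p) [^]\<^bsub>D (fst p)\<^esub> n = \<zero>\<^bsub>D (fst p)\<^esub>)"
      then show "ev (\<lambda>p. ldvd p (x (fst p)) (y (fst p) [^]\<^bsub>D (fst p)\<^esub> n))"
        by (rule ev_mono2[OF True]) (rule eq[THEN iffD2])
    qed
  qed
  then have "ultra_ideal \<Lambda> D \<U> Infty =
    {y \<in> carrier PR. \<exists>n::nat. ev (\<lambda>p. ldvd p (x (fst p)) (y (fst p) [^]\<^bsub>D (fst p)\<^esub> n))}"
    unfolding ultra_ideal_Infty by auto
  moreover have "Infty \<in> ext_positive (ultra_value_group \<Lambda> D \<U>)"
    by (simp add: ext_positive_def ext_le_def)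
  ultimately show ?thesis
    by (intro bexI)
next
  case False
  then have nz: "ev (\<lambda>p. x (fst p) \<noteq> \<zero>\<^bsub>D (fst p)\<^esub>)"
    by (simp add: ev_not_iff)
  \<comment> \<open>The default 1 at the zeros of \<open>x\<close> makes every quotient a group
    element. It changes nothing almost everywhere.\<close>
  define a where "a p = (if x (fst p) \<noteq> \<zero>\<^bsub>D (fst p)\<^esub> then x (fst p) else \<one>\<^bsub>D (fst p)\<^esub>)" for p :: "'i \<times> 'a set"
  define b where "b p = \<one>\<^bsub>D (fst p)\<^esub>" for p :: "'i \<times> 'a set"
  define \<gamma> where "\<gamma> = (\<lambda>p\<in>Y. fv p (a p) (b p))"
  have a: "a p \<in> carrier (D (fst p)) - {\<zero>\<^bsub>D (fst p)\<^esub>}" and b: "b p \<in> carrier (D (fst p)) - {\<zero>\<^bsub>D (fst p)\<^esub>}"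
    if p: "p \<in> Y" for p
  proof -
    interpret P: domain_prime "D (fst p)" "snd p"
      using domain_prime_at[OF p] .
    show "a p \<in> carrier (D (fst p)) - {\<zero>\<^bsub>D (fst p)\<^esub>}" "b p \<in> carrier (D (fst p)) - {\<zero>\<^bsub>D (fst p)\<^esub>}"
      unfolding a_def b_def using PR_closed_at[OF x p] by simp_all
  qed
  have \<gamma>: "\<gamma> \<in> VGs"
    unfolding \<gamma>_def using domain_prime.frac_value_closed[OF domain_prime_at] a b by simp
  have \<gamma>_eq: "\<gamma> p = fv p (a p) (b p)" if "p \<in> Y" for p
    using that by (simp add: \<gamma>_def)
  have "ev (\<lambda>p. \<not> ldvd p (a p) (b p))"
  proof (rule ev_mono2[OF nz xM])
    fix p assume p: "p \<in> Y" "x (fst p) \<noteq> \<zero>\<^bsub>D (fst p)\<^esub>" "x (fst p) \<in> snd p"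
    interpret P: domain_prime "D (fst p)" "snd p"
      using domain_prime_at[OF p(1)] .
    show "\<not> ldvd p (a p) (b p)"
      unfolding a_def b_def using p PR_closed_at[OF x p(1)] P.loc_dvd_one_iff by simp
  qed
  then have "Val (vcl \<gamma>) \<in> ext_positive (ultra_value_group \<Lambda> D \<U>)"
    using Val_mem_ext_positive_iff[OF \<gamma> a b \<gamma>_eq] by simp
  moreover have "ev (\<lambda>p. ldvd p (a p) (y (fst p) [^]\<^bsub>D (fst p)\<^esub> n \<otimes>\<^bsub>D (fst p)\<^esub> b p)) \<longleftrightarrow>
      ev (\<lambda>p. ldvd p (x (fst p)) (y (fst p) [^]\<^bsub>D (fst p)\<^esub> n))"
    if y: "y \<in> carrier PR" for y and n :: nat
  proof -
    have "y (fst p) [^]\<^bsub>D (fst p)\<^esub> n \<otimes>\<^bsub>D (fst p)\<^esub> b p = y (fst p) [^]\<^bsub>D (fst p)\<^esub> n" if p: "p \<in> Y" for p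
    proof -
      interpret P: domain_prime "D (fst p)" "snd p"
        using domain_prime_at[OF p] .
      show ?thesis
        unfolding b_def using PR_closed_at[OF y p] by simp
    qed
    then show ?thesis
      by (intro iffI; elim ev_mono2[OF nz]) (simp_all add: a_def)
  qed
  moreover have "ultra_ideal \<Lambda> D \<U> (Val (vcl \<gamma>)) = ideal_of_quotient a b"
    unfolding ideal_of_quotient_def by (rule ultra_ideal_Val[OF \<gamma> a b \<gamma>_eq])
  ultimately have "Val (vcl \<gamma>) \<in> ext_positive (ultra_value_group \<Lambda> D \<U>)"
    "ultra_ideal \<Lambda> D \<U> (Val (vcl \<gamma>)) =
      {y \<in> carrier PR. \<exists>n::nat. ev (\<lambda>p. ldvd p (x (fst p)) (y (fst p) [^]\<^bsub>D (fst p)\<^esub> n))}"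
    unfolding ideal_of_quotient_def by auto
  then show ?thesis
    by (intro bexI)
qed

section \<open>Order and ideal properties for a fixed value\<close>

lemma ideal_of_quotient_subset: "ideal_of_quotient a b \<subseteq> carrier PR"
  unfolding ideal_of_quotient_def by blast

text \<open>With v(a/b) \<le> v(c/d) \<le> v(x^n) the same exponent works for the smaller value.
  Clearing denominators brings in a factor \<open>d p\<close>, which is non-zero and cancels at the
  end.\<close>

lemma ideal_of_quotient_mono:
  assumes ab: "admissible a b" and cd: "admissible c d"
    and le: "ev (\<lambda>p. ldvd p (a p \<otimes>\<^bsub>D (fst p)\<^esub> d p) (c p \<otimes>\<^bsub>D (fst p)\<^esub> b p))"
  shows "ideal_of_quotient c d \<subseteq> ideal_of_quotient a b"
proof
  fix x assume "x \<in> ideal_of_quotient c d"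
  then obtain n :: nat where x: "x \<in> carrier PR"
    and n: "ev (\<lambda>p. ldvd p (c p) (x (fst p) [^]\<^bsub>D (fst p)\<^esub> n \<otimes>\<^bsub>D (fst p)\<^esub> d p))"
    unfolding ideal_of_quotient_def by auto
  have "ev (\<lambda>p. ldvd p (a p) (x (fst p) [^]\<^bsub>D (fst p)\<^esub> n \<otimes>\<^bsub>D (fst p)\<^esub> b p))"
  proof (rule ev_mono2[OF le n])
    fix p assume p: "p \<in> Y" and 1: "ldvd p (a p \<otimes>\<^bsub>D (fst p)\<^esub> d p) (c p \<otimes>\<^bsub>D (fst p)\<^esub> b p)"
      and 2: "ldvd p (c p) (x (fst p) [^]\<^bsub>D (fst p)\<^esub> n \<otimes>\<^bsub>D (fst p)\<^esub> d p)"
    interpret P: domain_prime "D (fst p)" "snd p"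
      using domain_prime_at[OF p] .
    note cl = admissibleD(1,3)[OF ab p] admissibleD(1,3)[OF cd p] PR_closed_at[OF x p]
    have "ldvd p (c p \<otimes>\<^bsub>D (fst p)\<^esub> b p) (x (fst p) [^]\<^bsub>D (fst p)\<^esub> n \<otimes>\<^bsub>D (fst p)\<^esub> d p \<otimes>\<^bsub>D (fst p)\<^esub> b p)"
      using P.loc_dvd_mult[OF 2 P.loc_dvd_refl[of "b p"]] cl by simp
    from P.loc_dvd_trans[OF 1 this] have "ldvd p (a p \<otimes>\<^bsub>D (fst p)\<^esub> d p) (x (fst p) [^]\<^bsub>D (fst p)\<^esub> n \<otimes>\<^bsub>D (fst p)\<^esub> d p \<otimes>\<^bsub>D (fst p)\<^esub> b p)"
      using cl by simp
    also have "x (fst p) [^]\<^bsub>D (fst p)\<^esub> n \<otimes>\<^bsub>D (fst p)\<^esub> d p \<otimes>\<^bsub>D (fst p)\<^esub> b p =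
        x (fst p) [^]\<^bsub>D (fst p)\<^esub> n \<otimes>\<^bsub>D (fst p)\<^esub> b p \<otimes>\<^bsub>D (fst p)\<^esub> d p"
      using cl by (simp add: P.m_ac)
    finally have "ldvd p (a p \<otimes>\<^bsub>D (fst p)\<^esub> d p)
        (x (fst p) [^]\<^bsub>D (fst p)\<^esub> n \<otimes>\<^bsub>D (fst p)\<^esub> b p \<otimes>\<^bsub>D (fst p)\<^esub> d p)" .
    from P.loc_dvd_cancel[OF this] show "ldvd p (a p) (x (fst p) [^]\<^bsub>D (fst p)\<^esub> n \<otimes>\<^bsub>D (fst p)\<^esub> b p)"
      using cl admissibleD(2)[OF cd p] by simp
  qed
  with x show "x \<in> ideal_of_quotient a b"
    unfolding ideal_of_quotient_def by auto
qed

text \<open>Any two values are comparable, first at each point and then, by \<open>ev_disj\<close>,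
  in the ultraproduct. The resulting chain makes unions closed under addition.\<close>

lemma ideal_of_quotient_linear:
  assumes ab: "admissible a b" and cd: "admissible c d"
  shows "ideal_of_quotient c d \<subseteq> ideal_of_quotient a b \<or> ideal_of_quotient a b \<subseteq> ideal_of_quotient c d"
proof -
  have "ev (\<lambda>p. ldvd p (a p \<otimes>\<^bsub>D (fst p)\<^esub> d p) (c p \<otimes>\<^bsub>D (fst p)\<^esub> b p) \<or>
      ldvd p (c p \<otimes>\<^bsub>D (fst p)\<^esub> b p) (a p \<otimes>\<^bsub>D (fst p)\<^esub> d p))"
  proof (rule ev_all)
    fix p assume p: "p \<in> Y"
    interpret P: pruefer_prime "D (fst p)" "snd p"
      using pruefer_prime_at[OF p] .
    show "ldvd p (a p \<otimes>\<^bsub>D (fst p)\<^esub> d p) (c p \<otimes>\<^bsub>D (fst p)\<^esub> b p) \<or>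
        ldvd p (c p \<otimes>\<^bsub>D (fst p)\<^esub> b p) (a p \<otimes>\<^bsub>D (fst p)\<^esub> d p)"
      using admissibleD(1,3)[OF ab p] admissibleD(1,3)[OF cd p] by (intro P.loc_dvd_total) simp_all
  qed
  from ev_disj[OF this] show ?thesis
    using ideal_of_quotient_mono[OF ab cd] ideal_of_quotient_mono[OF cd ab] by (elim disjE) simp_all
qed

text \<open>Membership is monotone in the value. Closure under sums and multiples, as well as
  primeness, is reduced to this.\<close>

lemma ideal_of_quotient_up:
  assumes ab: "admissible a b" and x: "x \<in> ideal_of_quotient a b" and z: "z \<in> carrier PR"
    and le: "ev (\<lambda>p. ldvd p (x (fst p)) (z (fst p)))"
  shows "z \<in> ideal_of_quotient a b"
proof -
  obtain n :: nat where x: "x \<in> carrier PR"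
    and n: "ev (\<lambda>p. ldvd p (a p) (x (fst p) [^]\<^bsub>D (fst p)\<^esub> n \<otimes>\<^bsub>D (fst p)\<^esub> b p))"
    using x unfolding ideal_of_quotient_def by auto
  have "ev (\<lambda>p. ldvd p (a p) (z (fst p) [^]\<^bsub>D (fst p)\<^esub> n \<otimes>\<^bsub>D (fst p)\<^esub> b p))"
  proof (rule ev_mono2[OF le n])
    fix p assume p: "p \<in> Y" and 1: "ldvd p (x (fst p)) (z (fst p))"
      and 2: "ldvd p (a p) (x (fst p) [^]\<^bsub>D (fst p)\<^esub> n \<otimes>\<^bsub>D (fst p)\<^esub> b p)"
    interpret P: domain_prime "D (fst p)" "snd p"
      using domain_prime_at[OF p] .
    note cl = admissibleD(1,3)[OF ab p] PR_closed_at[OF x p] PR_closed_at[OF z p]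
    have "ldvd p (x (fst p) [^]\<^bsub>D (fst p)\<^esub> n \<otimes>\<^bsub>D (fst p)\<^esub> b p)
        (z (fst p) [^]\<^bsub>D (fst p)\<^esub> n \<otimes>\<^bsub>D (fst p)\<^esub> b p)"
      using P.loc_dvd_mult[OF P.loc_dvd_pow[OF 1, of n] P.loc_dvd_refl[of "b p"]] cl by simp
    from P.loc_dvd_trans[OF 2 this]
    show "ldvd p (a p) (z (fst p) [^]\<^bsub>D (fst p)\<^esub> n \<otimes>\<^bsub>D (fst p)\<^esub> b p)"
      using cl by simp
  qed
  with z show "z \<in> ideal_of_quotient a b"
    unfolding ideal_of_quotient_def by auto
qed

lemma ev_ldvd_total:
  assumes "x \<in> carrier PR" "y \<in> carrier PR"
  shows "ev (\<lambda>p. ldvd p (x (fst p)) (y (fst p))) \<or> ev (\<lambda>p. ldvd p (y (fst p)) (x (fst p)))"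
proof (rule ev_disj, rule ev_all)
  fix p assume p: "p \<in> Y"
  show "ldvd p (x (fst p)) (y (fst p)) \<or> ldvd p (y (fst p)) (x (fst p))"
    using pruefer_prime.loc_dvd_total[OF pruefer_prime_at[OF p]] PR_closed_at[OF _ p] assms by simp
qed

text \<open>If \<open>u\<close> is the summand of smaller value and \<open>w\<close> the other one,
  the sum has value at least v(u), so the exponent found for \<open>u\<close> still works. No
  binomial expansion is needed.\<close>

lemma ideal_of_quotient_add:
  assumes ab: "admissible a b" and xy: "x \<in> ideal_of_quotient a b" "y \<in> ideal_of_quotient a b"
  shows "x \<oplus>\<^bsub>PR\<^esub> y \<in> ideal_of_quotient a b"
proof -
  have add: "u \<oplus>\<^bsub>PR\<^esub> w \<in> ideal_of_quotient a b" if u: "u \<in> ideal_of_quotient a b" and w: "w \<in> carrier PR"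
    and le: "ev (\<lambda>p. ldvd p (u (fst p)) (w (fst p)))" for u w
  proof (rule ideal_of_quotient_up[OF ab u])
    have u': "u \<in> carrier PR"
      using u ideal_of_quotient_subset by blast
    show "u \<oplus>\<^bsub>PR\<^esub> w \<in> carrier PR"
      using u' w by simp
    show "ev (\<lambda>p. ldvd p (u (fst p)) ((u \<oplus>\<^bsub>PR\<^esub> w) (fst p)))"
    proof (rule ev_mono[OF le])
      fix p assume p: "p \<in> Y" "ldvd p (u (fst p)) (w (fst p))"
      show "ldvd p (u (fst p)) ((u \<oplus>\<^bsub>PR\<^esub> w) (fst p))"
        unfolding PR_simps(2)[OF max_unionD(1)[OF p(1)]]
        using domain_prime.loc_dvd_add[OF domain_prime_at[OF p(1)] p(2)] PR_closed_at u' w p(1) by simp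
    qed
  qed
  have c: "x \<in> carrier PR" "y \<in> carrier PR"
    using xy ideal_of_quotient_subset by auto
  show ?thesis
    using ev_ldvd_total[OF c] add[OF xy(1) c(2)] add[OF xy(2) c(1)] PR.a_comm[OF c] by auto
qed

lemma ideal_of_quotient_mult:
  assumes ab: "admissible a b" and x: "x \<in> ideal_of_quotient a b" and r: "r \<in> carrier PR"
  shows "r \<otimes>\<^bsub>PR\<^esub> x \<in> ideal_of_quotient a b"
proof (rule ideal_of_quotient_up[OF ab x])
  have x': "x \<in> carrier PR"
    using x ideal_of_quotient_subset by blast
  show "r \<otimes>\<^bsub>PR\<^esub> x \<in> carrier PR"
    using x' r by simp
  show "ev (\<lambda>p. ldvd p (x (fst p)) ((r \<otimes>\<^bsub>PR\<^esub> x) (fst p)))"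
  proof (rule ev_all)
    fix p assume p: "p \<in> Y"
    interpret P: domain_prime "D (fst p)" "snd p"
      using domain_prime_at[OF p] .
    note cl = PR_closed_at[OF x' p] PR_closed_at[OF r p]
    have "ldvd p (x (fst p)) (x (fst p) \<otimes>\<^bsub>D (fst p)\<^esub> r (fst p))"
      using cl by (intro P.loc_dvd_mult_right P.loc_dvd_refl)
    then show "ldvd p (x (fst p)) ((r \<otimes>\<^bsub>PR\<^esub> x) (fst p))"
      unfolding PR_simps(1)[OF max_unionD(1)[OF p]] using cl by (simp add: P.m_comm)
  qed
qed

lemma zero_in_ideal_of_quotient:
  assumes ab: "admissible a b"
  shows "\<zero>\<^bsub>PR\<^esub> \<in> ideal_of_quotient a b"
proof -
  \<comment> \<open>The exponent has to be positive, since the zeroth power of zero is 1.\<close>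
  have "ev (\<lambda>p. ldvd p (a p) (\<zero>\<^bsub>PR\<^esub> (fst p) [^]\<^bsub>D (fst p)\<^esub> (1::nat) \<otimes>\<^bsub>D (fst p)\<^esub> b p))"
  proof (rule ev_all)
    fix p assume p: "p \<in> Y"
    interpret P: domain_prime "D (fst p)" "snd p"
      using domain_prime_at[OF p] .
    show "ldvd p (a p) (\<zero>\<^bsub>PR\<^esub> (fst p) [^]\<^bsub>D (fst p)\<^esub> (1::nat) \<otimes>\<^bsub>D (fst p)\<^esub> b p)"
      using admissibleD(1,3)[OF ab p] P.loc_dvd_zero by (simp add: PR_simps max_unionD[OF p])
  qed
  then have "\<exists>n::nat. ev (\<lambda>p. ldvd p (a p) (\<zero>\<^bsub>PR\<^esub> (fst p) [^]\<^bsub>D (fst p)\<^esub> n \<otimes>\<^bsub>D (fst p)\<^esub> b p))"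
    by (rule exI)
  with PR.zero_closed show ?thesis
    unfolding ideal_of_quotient_def by (intro CollectI conjI)
qed

lemma one_notin_ideal_of_quotient:
  assumes ab: "admissible a b"
  shows "\<one>\<^bsub>PR\<^esub> \<notin> ideal_of_quotient a b"
proof
  assume "\<one>\<^bsub>PR\<^esub> \<in> ideal_of_quotient a b"
  then obtain n :: nat where
    n: "ev (\<lambda>p. ldvd p (a p) (\<one>\<^bsub>PR\<^esub> (fst p) [^]\<^bsub>D (fst p)\<^esub> n \<otimes>\<^bsub>D (fst p)\<^esub> b p))"
    unfolding ideal_of_quotient_def by auto
  show False
  proof (rule ev_contradiction[OF n admissibleD(4)[OF ab]])
    fix p assume p: "p \<in> Y"
      and dvd: "ldvd p (a p) (\<one>\<^bsub>PR\<^esub> (fst p) [^]\<^bsub>D (fst p)\<^esub> n \<otimes>\<^bsub>D (fst p)\<^esub> b p)"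
      and "\<not> ldvd p (a p) (b p)"
    interpret P: domain_prime "D (fst p)" "snd p"
      using domain_prime_at[OF p] .
    have "\<one>\<^bsub>PR\<^esub> (fst p) [^]\<^bsub>D (fst p)\<^esub> n \<otimes>\<^bsub>D (fst p)\<^esub> b p = b p"
      using admissibleD(3)[OF ab p] by (simp add: PR_simps max_unionD[OF p])
    with dvd show False
      using \<open>\<not> ldvd p (a p) (b p)\<close> by simp
  qed
qed

text \<open>If \<open>u\<close> is the factor of larger value, then v(uw) \<le> v(u^2), so the
  square of \<open>u\<close> belongs to the ideal. An exponent n for the square is the exponent n +
  n for \<open>u\<close>.\<close>

lemma ideal_of_quotient_prime:
  assumes ab: "admissible a b" and x: "x \<in> carrier PR" and y: "y \<in> carrier PR"
    and xy: "x \<otimes>\<^bsub>PR\<^esub> y \<in> ideal_of_quotient a b"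
  shows "x \<in> ideal_of_quotient a b \<or> y \<in> ideal_of_quotient a b"
proof -
  have main: "u \<in> ideal_of_quotient a b" if u: "u \<in> carrier PR" and w: "w \<in> carrier PR"
    and uw: "u \<otimes>\<^bsub>PR\<^esub> w \<in> ideal_of_quotient a b" and le: "ev (\<lambda>p. ldvd p (w (fst p)) (u (fst p)))" for u w
  proof -
    have "u \<otimes>\<^bsub>PR\<^esub> u \<in> ideal_of_quotient a b"
    proof (rule ideal_of_quotient_up[OF ab uw])
      show "u \<otimes>\<^bsub>PR\<^esub> u \<in> carrier PR"
        using u by simp
      show "ev (\<lambda>p. ldvd p ((u \<otimes>\<^bsub>PR\<^esub> w) (fst p)) ((u \<otimes>\<^bsub>PR\<^esub> u) (fst p)))"
      proof (rule ev_mono[OF le])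
        fix p assume p: "p \<in> Y" and wu: "ldvd p (w (fst p)) (u (fst p))"
        interpret P: domain_prime "D (fst p)" "snd p"
          using domain_prime_at[OF p] .
        note cl = PR_closed_at[OF u p] PR_closed_at[OF w p]
        show "ldvd p ((u \<otimes>\<^bsub>PR\<^esub> w) (fst p)) ((u \<otimes>\<^bsub>PR\<^esub> u) (fst p))"
          unfolding PR_simps(1)[OF max_unionD(1)[OF p]]
          using cl by (intro P.loc_dvd_mult wu P.loc_dvd_refl) simp_all
      qed
    qed
    then obtain n :: nat where
      n: "ev (\<lambda>p. ldvd p (a p) ((u \<otimes>\<^bsub>PR\<^esub> u) (fst p) [^]\<^bsub>D (fst p)\<^esub> n \<otimes>\<^bsub>D (fst p)\<^esub> b p))"
      unfolding ideal_of_quotient_def by auto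
    have "ev (\<lambda>p. ldvd p (a p) (u (fst p) [^]\<^bsub>D (fst p)\<^esub> (n + n) \<otimes>\<^bsub>D (fst p)\<^esub> b p))"
    proof (rule ev_mono[OF n])
      fix p assume p: "p \<in> Y"
        and dvd: "ldvd p (a p) ((u \<otimes>\<^bsub>PR\<^esub> u) (fst p) [^]\<^bsub>D (fst p)\<^esub> n \<otimes>\<^bsub>D (fst p)\<^esub> b p)"
      interpret P: domain_prime "D (fst p)" "snd p"
        using domain_prime_at[OF p] .
      have "(u \<otimes>\<^bsub>PR\<^esub> u) (fst p) [^]\<^bsub>D (fst p)\<^esub> n = u (fst p) [^]\<^bsub>D (fst p)\<^esub> (n + n)"
        unfolding PR_simps(1)[OF max_unionD(1)[OF p]]
        using PR_closed_at[OF u p] by (simp add: P.nat_pow_distrib P.nat_pow_mult)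
      with dvd show "ldvd p (a p) (u (fst p) [^]\<^bsub>D (fst p)\<^esub> (n + n) \<otimes>\<^bsub>D (fst p)\<^esub> b p)"
        by simp
    qed
    with u show ?thesis
      unfolding ideal_of_quotient_def by auto
  qed
  show ?thesis
    using ev_ldvd_total[OF x y] main[OF x y] main[OF y x] xy PR.m_comm[OF x y] by auto
qed

section \<open>Prime ideals and unions for a fixed ultrafilter\<close>

lemma primeideal_Union_ultra_ideal:
  assumes I: "I \<noteq> {}" "I \<subseteq> ext_positive (ultra_value_group \<Lambda> D \<U>)"
  shows "primeideal (\<Union>g\<in>I. ultra_ideal \<Lambda> D \<U> g) PR"
proof -
  define Q where "Q = (\<Union>g\<in>I. ultra_ideal \<Lambda> D \<U> g)"
  have rep: "\<exists>a b. admissible a b \<and> ultra_ideal \<Lambda> D \<U> g = ideal_of_quotient a b" if "g \<in> I" for g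
    using that I(2) ultra_ideal_representation by blast
  have memE: "\<exists>a b. admissible a b \<and> x \<in> ideal_of_quotient a b \<and> ideal_of_quotient a b \<subseteq> Q" if x: "x \<in> Q" for x
  proof -
    obtain g where g: "g \<in> I" "x \<in> ultra_ideal \<Lambda> D \<U> g"
      using x unfolding Q_def by blast
    then have "ultra_ideal \<Lambda> D \<U> g \<subseteq> Q"
      unfolding Q_def by blast
    then show ?thesis
      using rep[OF g(1)] g(2) by auto
  qed
  have mult: "r \<otimes>\<^bsub>PR\<^esub> x \<in> Q" if x: "x \<in> Q" and r: "r \<in> carrier PR" for x r
  proof -
    obtain a b where ab: "admissible a b" "x \<in> ideal_of_quotient a b" "ideal_of_quotient a b \<subseteq> Q"
      using memE[OF x] by auto
    then show ?thesis
      using ideal_of_quotient_mult[OF ab(1,2) r] by auto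
  qed
  have sub: "Q \<subseteq> carrier PR"
    unfolding Q_def ultra_ideal_def by blast
  have "primeideal Q PR"
  proof (rule primeidealI2)
    show "additive_subgroup Q PR"
    proof (rule additive_subgroupI, rule group.subgroupI)
      show "group (add_monoid PR)"
        by (rule PR.a_group)
      show "Q \<subseteq> carrier (add_monoid PR)"
        using sub by simp
      obtain g where g: "g \<in> I"
        using I(1) by blast
      then show "Q \<noteq> {}"
        using rep[OF g] zero_in_ideal_of_quotient unfolding Q_def by blast
      fix x assume x: "x \<in> Q"
      then have xc: "x \<in> carrier PR"
        using sub by blast
      have "\<ominus>\<^bsub>PR\<^esub> \<one>\<^bsub>PR\<^esub> \<otimes>\<^bsub>PR\<^esub> x \<in> Q"
        using x by (rule mult) simp
      also have "\<ominus>\<^bsub>PR\<^esub> \<one>\<^bsub>PR\<^esub> \<otimes>\<^bsub>PR\<^esub> x = \<ominus>\<^bsub>PR\<^esub> x"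
        using xc by (simp add: PR.l_minus)
      finally show "inv\<^bsub>add_monoid PR\<^esub> x \<in> Q"
        by (simp add: a_inv_def)
      fix y assume y: "y \<in> Q"
      obtain a b c d where ab: "admissible a b" "x \<in> ideal_of_quotient a b" "ideal_of_quotient a b \<subseteq> Q"
        and cd: "admissible c d" "y \<in> ideal_of_quotient c d" "ideal_of_quotient c d \<subseteq> Q"
        using memE[OF x] memE[OF y] by auto
      \<comment> \<open>The members of the union form a chain, so one of them contains both
        summands.\<close>
      have "x \<oplus>\<^bsub>PR\<^esub> y \<in> Q"
        using ideal_of_quotient_linear[OF ab(1) cd(1)]
      proof
        assume "ideal_of_quotient c d \<subseteq> ideal_of_quotient a b"
        then show ?thesis
          using ideal_of_quotient_add[OF ab(1,2), of y] ab(3) cd(2) by blast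
      next
        assume "ideal_of_quotient a b \<subseteq> ideal_of_quotient c d"
        then show ?thesis
          using ideal_of_quotient_add[OF cd(1) _ cd(2), of x] ab(2) cd(3) by blast
      qed
      then show "x \<otimes>\<^bsub>add_monoid PR\<^esub> y \<in> Q"
        by simp
    qed
    show "cring PR"
      by (rule cring_PR)
    show "carrier PR \<noteq> Q"
    proof
      assume "carrier PR = Q"
      then have "\<one>\<^bsub>PR\<^esub> \<in> Q"
        using PR.one_closed by simp
      from memE[OF this] show False
        using one_notin_ideal_of_quotient by blast
    qed
    fix x r assume x: "x \<in> Q" and r: "r \<in> carrier PR"
    show "r \<otimes>\<^bsub>PR\<^esub> x \<in> Q"
      using mult[OF x r] .
    moreover have "x \<in> carrier PR"
      using x sub by blast
    ultimately show "x \<otimes>\<^bsub>PR\<^esub> r \<in> Q"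
      using r by (simp add: PR.m_comm)
  next
    fix x y assume c: "x \<in> carrier PR" "y \<in> carrier PR" and "x \<otimes>\<^bsub>PR\<^esub> y \<in> Q"
    from memE[OF this(3)] obtain a b where ab: "admissible a b" "x \<otimes>\<^bsub>PR\<^esub> y \<in> ideal_of_quotient a b" "ideal_of_quotient a b \<subseteq> Q"
      by auto
    from ideal_of_quotient_prime[OF ab(1) c ab(2)] show "x \<in> Q \<or> y \<in> Q"
      using ab(3) by auto
  qed
  then show ?thesis
    unfolding Q_def .
qed

text \<open>With \<open>z = y\<^sup>n\<close> the hypothesis gives \<open>v(z\<^sup>2) > v(x)\<close>, unless both are infinite, since
  \<open>v(x) > 0\<close>; the witness \<open>a\<close> for \<open>x\<close> and \<open>z\<^sup>2\<close> then avoids the maximal ideals in question, so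
  \<open>a z\<^sup>2 \<in> x R \<subseteq> P\<close> forces \<open>z\<^sup>2 \<in> P\<close>.\<close>

lemma primeideal_closed_valuation:
  assumes P: "primeideal P PR" and ev_P: "\<And>x. x \<in> P \<Longrightarrow> ev (\<lambda>p. x (fst p) \<in> snd p)"
    and x: "x \<in> P" and y: "y \<in> carrier PR"
    and le: "ev (\<lambda>p. ldvd p (x (fst p)) (y (fst p) [^]\<^bsub>D (fst p)\<^esub> (n::nat)))"
  shows "y \<in> P"
proof -
  interpret P: primeideal P PR
    using P .
  have xc: "x \<in> carrier PR"
    using x P.a_subset by blast
  define z where "z = y [^]\<^bsub>PR\<^esub> n"
  have z: "z \<in> carrier PR"
    using y by (simp add: z_def)
  have le: "ev (\<lambda>p. ldvd p (x (fst p)) (z (fst p)))"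
    by (rule ev_mono[OF le]) (simp add: z_def PR_pow max_unionD)
  \<comment> \<open>Comparison witnesses for \<open>x\<close> and the square of \<open>z\<close>,
    chosen for each index and not for each maximal ideal. This makes the resulting \<open>a'\<close>
    an element of R.\<close>
  define W where "W l a c d \<longleftrightarrow> a \<in> carrier (D l) \<and> c \<in> carrier (D l) \<and> d \<in> carrier (D l) \<and>
      a \<otimes>\<^bsub>D l\<^esub> (z l \<otimes>\<^bsub>D l\<^esub> z l) = x l \<otimes>\<^bsub>D l\<^esub> c \<and>
      (\<one>\<^bsub>D l\<^esub> \<ominus>\<^bsub>D l\<^esub> a) \<otimes>\<^bsub>D l\<^esub> x l = (z l \<otimes>\<^bsub>D l\<^esub> z l) \<otimes>\<^bsub>D l\<^esub> d \<and>
      (z l \<otimes>\<^bsub>D l\<^esub> z l = \<zero>\<^bsub>D l\<^esub> \<longrightarrow> a = \<one>\<^bsub>D l\<^esub>)" for l a c d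
  have "\<exists>a c d. W l a c d" if l: "l \<in> \<Lambda>" for l
  proof -
    interpret L: pruefer "D l"
      using pruefer_at[OF l] .
    show ?thesis
      using L.comparison_witness[of "x l" "z l \<otimes>\<^bsub>D l\<^esub> z l"] PR_closed[OF xc l] PR_closed[OF z l]
      unfolding W_def by auto
  qed
  then obtain a c d where W: "\<And>l. l \<in> \<Lambda> \<Longrightarrow> W l (a l) (c l) (d l)"
    by metis
  have acd: "a l \<in> carrier (D l)" "c l \<in> carrier (D l)" "d l \<in> carrier (D l)"
    and 1: "a l \<otimes>\<^bsub>D l\<^esub> (z l \<otimes>\<^bsub>D l\<^esub> z l) = x l \<otimes>\<^bsub>D l\<^esub> c l"
    and 2: "(\<one>\<^bsub>D l\<^esub> \<ominus>\<^bsub>D l\<^esub> a l) \<otimes>\<^bsub>D l\<^esub> x l = (z l \<otimes>\<^bsub>D l\<^esub> z l) \<otimes>\<^bsub>D l\<^esub> d l"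
    and 3: "z l \<otimes>\<^bsub>D l\<^esub> z l = \<zero>\<^bsub>D l\<^esub> \<longrightarrow> a l = \<one>\<^bsub>D l\<^esub>"
    if "l \<in> \<Lambda>" for l
    using W[OF that] unfolding W_def by simp_all
  define a' where "a' = restrict a \<Lambda>"
  define c' where "c' = restrict c \<Lambda>"
  have a': "a' \<in> carrier PR" and c': "c' \<in> carrier PR"
    using acd by (simp_all add: a'_def c'_def carrier_PR)
  have "a' \<otimes>\<^bsub>PR\<^esub> (z \<otimes>\<^bsub>PR\<^esub> z) = x \<otimes>\<^bsub>PR\<^esub> c'"
    using a' c' z xc by (intro PR_eqI) (simp_all add: PR_simps a'_def c'_def 1)
  moreover have "x \<otimes>\<^bsub>PR\<^esub> c' \<in> P"
    using x c' by (rule P.I_r_closed)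
  ultimately have "a' \<otimes>\<^bsub>PR\<^esub> (z \<otimes>\<^bsub>PR\<^esub> z) \<in> P"
    by simp
  \<comment> \<open>An element of \<open>P\<close> lies in almost all of the maximal ideals, whereas
    \<open>a'\<close> avoids each one that contains the component of \<open>x\<close> and at which
    \<open>x\<close> has value at most that of \<open>z\<close>.\<close>
  moreover have "a' \<notin> P"
  proof
    assume "a' \<in> P"
    then have a_ev: "ev (\<lambda>p. a' (fst p) \<in> snd p)"
      by (rule ev_P)
    show False
    proof (rule ev_contradiction[OF a_ev ev_conj[OF ev_P[OF x] le]])
      fix p assume p: "p \<in> Y" and ap: "a' (fst p) \<in> snd p"
        and xp: "x (fst p) \<in> snd p \<and> ldvd p (x (fst p)) (z (fst p))"
      interpret M: pruefer_prime "D (fst p)" "snd p"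
        using pruefer_prime_at[OF p] .
      note l = max_unionD(1)[OF p]
      have "a (fst p) \<notin> snd p"
        by (rule M.comparison_witness_notin[OF acd(1,3)[OF l] conjunct1[OF xp] PR_closed[OF z l]
              conjunct2[OF xp] 2[OF l] 3[OF l]])
      then show False
        using ap l by (simp add: a'_def)
    qed
  qed
  ultimately have "z \<otimes>\<^bsub>PR\<^esub> z \<in> P"
    using P.I_prime[OF a', of "z \<otimes>\<^bsub>PR\<^esub> z"] z by simp
  then have "z \<in> P"
    using P.I_prime[OF z z] by simp
  then show "y \<in> P"
    unfolding z_def by (rule P.pow_memD[OF y])
qed

text \<open>The index set consists of all positive g whose ideal is contained in \<open>P\<close>.
  Every x in \<open>P\<close> is covered by g = v(x) with exponent 1, and this g qualifies by
  \<open>primeideal_closed_valuation\<close>. Applied to 0, this also shows that the index set is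
  non-empty.\<close>

lemma primeideal_eq_Union_ultra_ideal:
  assumes P: "primeideal P PR" and ev_P: "\<And>x. x \<in> P \<Longrightarrow> ev (\<lambda>p. x (fst p) \<in> snd p)"
  shows "\<exists>I. I \<noteq> {} \<and> I \<subseteq> ext_positive (ultra_value_group \<Lambda> D \<U>) \<and>
    P = (\<Union>g\<in>I. ultra_ideal \<Lambda> D \<U> g)"
proof -
  interpret P: primeideal P PR
    using P .
  let ?I = "{g \<in> ext_positive (ultra_value_group \<Lambda> D \<U>). ultra_ideal \<Lambda> D \<U> g \<subseteq> P}"
  have ex: "\<exists>g\<in>?I. x \<in> ultra_ideal \<Lambda> D \<U> g" if x: "x \<in> P" for x
  proof -
    have xc: "x \<in> carrier PR"
      using x P.a_subset by blast
    from ultra_ideal_of_element[OF xc ev_P[OF x]]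
    obtain g where g: "g \<in> ext_positive (ultra_value_group \<Lambda> D \<U>)" and eq: "ultra_ideal \<Lambda> D \<U> g =
        {y \<in> carrier PR. \<exists>n::nat. ev (\<lambda>p. ldvd p (x (fst p)) (y (fst p) [^]\<^bsub>D (fst p)\<^esub> n))}"
      by (rule bexE)
    have "ultra_ideal \<Lambda> D \<U> g \<subseteq> P"
      unfolding eq using primeideal_closed_valuation[OF P ev_P x] by auto
    moreover have "ev (\<lambda>p. ldvd p (x (fst p)) (x (fst p) [^]\<^bsub>D (fst p)\<^esub> (1::nat)))"
    proof (rule ev_all)
      fix p assume p: "p \<in> Y"
      interpret P: domain_prime "D (fst p)" "snd p"
        using domain_prime_at[OF p] .
      show "ldvd p (x (fst p)) (x (fst p) [^]\<^bsub>D (fst p)\<^esub> (1::nat))"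
        using PR_closed_at[OF xc p] P.loc_dvd_refl by simp
    qed
    then have "\<exists>n::nat. ev (\<lambda>p. ldvd p (x (fst p)) (x (fst p) [^]\<^bsub>D (fst p)\<^esub> n))"
      by (rule exI)
    with xc have "x \<in> ultra_ideal \<Lambda> D \<U> g"
      unfolding eq by (intro CollectI conjI)
    ultimately show ?thesis
      using g by auto
  qed
  have "?I \<noteq> {}"
    using ex[OF P.zero_closed] by auto
  moreover have "P = (\<Union>g\<in>?I. ultra_ideal \<Lambda> D \<U> g)"
    using ex by blast
  ultimately show ?thesis
    by (intro exI[of _ ?I]) auto
qed

end

section \<open>An ultrafilter from a proper ideal\<close>

context pruefer_family
begin

text \<open>The same finite list of generators is used at every index, so the coefficients chosen
  independently at the indices assemble into finitely many elements of R. The induction splits off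
  one generator and applies the hypothesis to the assembled remainder.\<close>

lemma mem_ideal_if_pointwise:
  assumes P: "ideal P PR"
  shows "finite A \<Longrightarrow> A \<subseteq> P \<Longrightarrow> e \<in> carrier PR \<Longrightarrow>
    (\<And>l. l \<in> \<Lambda> \<Longrightarrow> e l \<in> genideal (D l) ((\<lambda>x. x l) ` A)) \<Longrightarrow> e \<in> P"
proof (induction A arbitrary: e rule: finite_induct)
  interpret P: ideal P PR
    using P .
  case empty
  have "e l = \<zero>\<^bsub>PR\<^esub> l" if l: "l \<in> \<Lambda>" for l
  proof -
    interpret L: cring "D l"
      using cring_at[OF l] .
    have "genideal (D l) {} \<subseteq> {\<zero>\<^bsub>D l\<^esub>}"
      by (rule L.genideal_minimal[OF L.zeroideal]) simp
    then show ?thesis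
      using empty(3)[OF l] l by (auto simp: PR_simps)
  qed
  then have "e = \<zero>\<^bsub>PR\<^esub>"
    using empty(2) by (intro PR_eqI) simp_all
  then show ?case
    using P.zero_closed by simp
next
  interpret P: ideal P PR
    using P .
  case (insert x A)
  have xP: "x \<in> P" and AP: "A \<subseteq> P"
    using insert.prems(1) by auto
  have PR_sub: "y \<in> carrier PR" if "y \<in> P" for y
    using that P.a_subset by blast
  have "\<exists>r s. r \<in> carrier (D l) \<and> s \<in> genideal (D l) ((\<lambda>x. x l) ` A) \<and> s \<in> carrier (D l) \<and>
      e l = r \<otimes>\<^bsub>D l\<^esub> x l \<oplus>\<^bsub>D l\<^esub> s" if l: "l \<in> \<Lambda>" for l
  proof -
    interpret L: cring "D l"
      using cring_at[OF l] .
    have A: "(\<lambda>x. x l) ` A \<subseteq> carrier (D l)"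
      using AP PR_sub PR_closed[OF _ l] by auto
    have "e l \<in> genideal (D l) (insert (x l) ((\<lambda>x. x l) ` A))"
      using insert.prems(3)[OF l] by simp
    then obtain r s where "r \<in> carrier (D l)" "s \<in> genideal (D l) ((\<lambda>x. x l) ` A)"
        "e l = r \<otimes>\<^bsub>D l\<^esub> x l \<oplus>\<^bsub>D l\<^esub> s"
      using PR_closed[OF PR_sub[OF xP] l] A by (rule L.mem_genideal_insertE)
    moreover from this have "s \<in> carrier (D l)"
      using ideal.Icarr[OF L.genideal_ideal[OF A]] by simp
    ultimately show ?thesis
      by auto
  qed
  then obtain r s where r: "\<And>l. l \<in> \<Lambda> \<Longrightarrow> r l \<in> carrier (D l)"
    and s: "\<And>l. l \<in> \<Lambda> \<Longrightarrow> s l \<in> genideal (D l) ((\<lambda>x. x l) ` A)" "\<And>l. l \<in> \<Lambda> \<Longrightarrow> s l \<in> carrier (D l)"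
    and e: "\<And>l. l \<in> \<Lambda> \<Longrightarrow> e l = r l \<otimes>\<^bsub>D l\<^esub> x l \<oplus>\<^bsub>D l\<^esub> s l"
    by metis
  have rc: "restrict r \<Lambda> \<in> carrier PR" and sc: "restrict s \<Lambda> \<in> carrier PR"
    using r s by (simp_all add: carrier_PR)
  have sP: "restrict s \<Lambda> \<in> P"
    using AP sc by (rule insert.IH) (simp add: s)
  have "e = restrict r \<Lambda> \<otimes>\<^bsub>PR\<^esub> x \<oplus>\<^bsub>PR\<^esub> restrict s \<Lambda>"
    using insert.prems(2) rc sc PR_sub[OF xP] by (intro PR_eqI) (simp_all add: PR_simps e)
  then show ?case
    using P.a_closed[OF P.I_l_closed[OF xP rc] sP] by simp
qed

lemma finite_subset_common_maximal:
  assumes P: "ideal P PR" "P \<noteq> carrier PR" and A: "finite A" "A \<subseteq> P"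
  shows "\<exists>p\<in>max_union \<Lambda> D. \<forall>x\<in>A. x (fst p) \<in> snd p"
proof (rule ccontr)
  interpret P: ideal P PR
    using P(1) .
  assume no: "\<not> (\<exists>p\<in>max_union \<Lambda> D. \<forall>x\<in>A. x (fst p) \<in> snd p)"
  have "\<one>\<^bsub>PR\<^esub> l \<in> genideal (D l) ((\<lambda>x. x l) ` A)" if l: "l \<in> \<Lambda>" for l
  proof -
    interpret L: cring "D l"
      using cring_at[OF l] .
    have Al: "(\<lambda>x. x l) ` A \<subseteq> carrier (D l)"
      using A(2) P.a_subset PR_closed[OF _ l] by auto
    have "genideal (D l) ((\<lambda>x. x l) ` A) = carrier (D l)"
    proof (rule ccontr)
      assume "genideal (D l) ((\<lambda>x. x l) ` A) \<noteq> carrier (D l)"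
      then obtain M where "maximalideal M (D l)" "genideal (D l) ((\<lambda>x. x l) ` A) \<subseteq> M"
        using L.exists_maximalideal[OF L.genideal_ideal[OF Al]] by auto
      then have "(l, M) \<in> max_union \<Lambda> D" "\<forall>x\<in>A. x (fst (l, M)) \<in> snd (l, M)"
        using l L.genideal_self[OF Al] by (auto simp: max_union_def max_ideals_def)
      with no show False
        by blast
    qed
    then show ?thesis
      using l by (simp add: PR_simps)
  qed
  then have "\<one>\<^bsub>PR\<^esub> \<in> P"
    using mem_ideal_if_pointwise[OF P(1) A PR.one_closed] by simp
  then show False
    using P.one_imp_carrier P(2) by simp
qed

text \<open>Indexing the sets by finite subsets of \<open>P\<close> makes the family closed under
  intersection, since \<open>V A\<close> and \<open>V B\<close> meet in
  \<open>V (A \<union> B)\<close>. No such set is empty by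
  \<open>finite_subset_common_maximal\<close>.\<close>

lemma exists_ultrafilter_common_maximal:
  assumes P: "ideal P PR" "P \<noteq> carrier PR"
  shows "\<exists>\<U>. ultrafilter_on (max_union \<Lambda> D) \<U> \<and>
    (\<forall>x\<in>P. {p \<in> max_union \<Lambda> D. x (fst p) \<in> snd p} \<in> \<U>)"
proof -
  define V where "V A = {p \<in> max_union \<Lambda> D. \<forall>x\<in>A. x (fst p) \<in> snd p}" for A
  have "\<exists>\<U>. ultrafilter_on (max_union \<Lambda> D) \<U> \<and> V ` {A. finite A \<and> A \<subseteq> P} \<subseteq> \<U>"
  proof (rule ultrafilter_extends)
    show "V ` {A. finite A \<and> A \<subseteq> P} \<subseteq> Pow (max_union \<Lambda> D)"
      unfolding V_def by blast
    show "V ` {A. finite A \<and> A \<subseteq> P} \<noteq> {}"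
      by blast
    have "V A \<noteq> {}" if "finite A" "A \<subseteq> P" for A
      using finite_subset_common_maximal[OF P that] unfolding V_def by blast
    then show "{} \<notin> V ` {A. finite A \<and> A \<subseteq> P}"
      by auto
    fix S T assume "S \<in> V ` {A. finite A \<and> A \<subseteq> P}" "T \<in> V ` {A. finite A \<and> A \<subseteq> P}"
    then obtain A B where "finite A" "A \<subseteq> P" "finite B" "B \<subseteq> P" "S = V A" "T = V B"
      by auto
    moreover have "V A \<inter> V B = V (A \<union> B)"
      unfolding V_def by auto
    ultimately show "S \<inter> T \<in> V ` {A. finite A \<and> A \<subseteq> P}"
      by auto
  qed
  then obtain \<U> where \<U>: "ultrafilter_on (max_union \<Lambda> D) \<U>" "V ` {A. finite A \<and> A \<subseteq> P} \<subseteq> \<U>"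
    by auto
  have "{p \<in> max_union \<Lambda> D. x (fst p) \<in> snd p} \<in> \<U>" if "x \<in> P" for x
  proof -
    have "V {x} \<in> \<U>"
      using \<U>(2) that by auto
    then show ?thesis
      unfolding V_def by simp
  qed
  with \<U>(1) show ?thesis
    by auto
qed

end

theorem theorem3p6:
  fixes \<Lambda> :: "'i set" and D :: "'i \<Rightarrow> ('a, 'm) ring_scheme" and P :: "('i \<Rightarrow> 'a) set"
  assumes "\<And>l. l \<in> \<Lambda> \<Longrightarrow> pruefer_domain (D l)"
    and "P \<subseteq> carrier (product_ring \<Lambda> D)"
  shows "primeideal P (product_ring \<Lambda> D) \<longleftrightarrow>
    (\<exists>\<U> I. ultrafilter_on (max_union \<Lambda> D) \<U> \<and>
      I \<noteq> {} \<and> I \<subseteq> ext_positive (ultra_value_group \<Lambda> D \<U>) \<and>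
      P = (\<Union>g\<in>I. ultra_ideal \<Lambda> D \<U> g))"
proof
  interpret pruefer_family \<Lambda> D
    using assms(1) by unfold_locales
  assume P: "primeideal P PR"
  then have "ideal P PR" "P \<noteq> carrier PR"
    using primeideal.axioms(1) primeideal.I_notcarr by auto
  from exists_ultrafilter_common_maximal[OF this]
  obtain \<U> where \<U>: "ultrafilter_on (max_union \<Lambda> D) \<U>"
    and V: "\<And>x. x \<in> P \<Longrightarrow> {p \<in> max_union \<Lambda> D. x (fst p) \<in> snd p} \<in> \<U>"
    by auto
  interpret pruefer_ultra \<Lambda> D \<U>
    using \<U> by unfold_locales
  show "\<exists>\<U> I. ultrafilter_on (max_union \<Lambda> D) \<U> \<and>
      I \<noteq> {} \<and> I \<subseteq> ext_positive (ultra_value_group \<Lambda> D \<U>) \<and>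
      P = (\<Union>g\<in>I. ultra_ideal \<Lambda> D \<U> g)"
    using primeideal_eq_Union_ultra_ideal[OF P] V \<U> unfolding ev_def by blast
next
  interpret pruefer_family \<Lambda> D
    using assms(1) by unfold_locales
  assume "\<exists>\<U> I. ultrafilter_on (max_union \<Lambda> D) \<U> \<and>
      I \<noteq> {} \<and> I \<subseteq> ext_positive (ultra_value_group \<Lambda> D \<U>) \<and>
      P = (\<Union>g\<in>I. ultra_ideal \<Lambda> D \<U> g)"
  then obtain \<U> I where \<U>: "ultrafilter_on (max_union \<Lambda> D) \<U>"
    and I: "I \<noteq> {}" "I \<subseteq> ext_positive (ultra_value_group \<Lambda> D \<U>)"
    and P: "P = (\<Union>g\<in>I. ultra_ideal \<Lambda> D \<U> g)"
    by auto
  interpret pruefer_ultra \<Lambda> D \<U>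
    using \<U> by unfold_locales
  show "primeideal P PR"
    unfolding P using I by (rule primeideal_Union_ultra_ideal)
qed

end
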